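(* Let $\tilde X$ be the Markov process on $\mathbb{Z}_+^N$ associated with the modified proportional fair allocation $\tilde\phi=\phi^{mPF}$, with arrival rates $\lambda\in\mathrm{int}(\mathcal{C})$. For $\delta>0$ let $$G(x)=\exp(\delta F(x)),\qquad F(x)=\left(\sum_{i=1}^N\frac{x_i^2}{\lambda_i}\right)^{1/2}.$$ Then there exist constants $\delta>0$, $\gamma>0$ and $\tilde K$ such that for all $x\in\mathbb{Z}_+^N$ with $|x|>\tilde K$, $$\tilde\Delta G(x)\le-\gamma\,G(x),$$ where $\tilde\Delta$ is the generator of $\tilde X$. Hence there exist constants $K_3,K_4>0$ such that for all $x\in\mathbb{Z}_+^N$ and $t\ge0$, $$\left|P^0_t(x)-\pi^{mPF}(x)\right|\le K_3e^{-K_4t},$$ where $P^0_t(x)=\mathbb{P}(\tilde X_t=x\mid\tilde X_0=0)$ and $\pi^{mPF}$ is the stationary distribution of $\tilde X$.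
   Context: $N\ge 1$; $e_i$ is the $i$-th unit vector; $|x|=\sum_i|x_i|$. The capacity set $\mathcal{C}\subset\mathbb{R}_+^N$ is a compact convex set containing $\{\eta\in\mathbb{R}_+^N:\sum_i\eta_i\le c\}$ for some $c>0$. Potential of the proportional fair allocation: $P^{PF}(x)=\max_{\eta\in\mathcal{C}}\sum_{i:x_i>0}x_i\log\eta_i$, $P^{PF}(0)=0$. Modified proportional fair allocation: $\log\phi^{mPF}_i(x)=P^{PF}(x)-P^{PF}(x-e_i)$ for $x\in\mathbb{Z}_+^N$ with $x_i\ge1$, and $\phi^{mPF}_i(x)=0$ if $x_i=0$. The process associated with $\tilde\phi$ is the continuous-time Markov process on $\mathbb{Z}_+^N$ with transition rates $q(x,x+e_i)=\lambda_i$, $q(x,x-e_i)=\tilde\phi_i(x)$, and its generator is $$\tilde\Delta f(x)=\sum_{i=1}^N\lambda_i\left(f(x+e_i)-f(x)\right)+\tilde\phi_i(x)\left(f(x-e_i)-f(x)\right).$$ *)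

theory Defs
  imports "HOL-Probability.Probability"
begin

section \<open>Capacity set and modified proportional fair allocation\<close>

definition capacity_set :: "(real ^ 'n::finite) set \<Rightarrow> bool" where
  "capacity_set C \<longleftrightarrow>
     compact C \<and> convex C \<and> (\<forall>\<eta>\<in>C. \<forall>i. 0 \<le> \<eta> $ i) \<and>
     (\<exists>c>0. {\<eta>. (\<forall>i. 0 \<le> \<eta> $ i) \<and> (\<Sum>i\<in>UNIV. \<eta> $ i) \<le> c} \<subseteq> C)"

text \<open>
  The convention log 0 = -infinity is implemented by maximising only over those
  \<open>\<eta>\<close> in \<open>C\<close> with \<open>\<eta>\<^sub>i > 0\<close> whenever \<open>x\<^sub>i > 0\<close> (in HOL, \<open>ln 0 = 0\<close>).
  For a capacity set this set of \<open>\<eta>\<close> is nonempty and, by compactness, the supremum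
  is a maximum.
\<close>

definition PF_potential :: "(real ^ 'n::finite) set \<Rightarrow> nat ^ 'n \<Rightarrow> real" where
  "PF_potential C x =
     (if x = 0 then 0
      else (SUP \<eta> \<in> {\<eta>\<in>C. \<forall>i. x $ i > 0 \<longrightarrow> \<eta> $ i > 0}.
              \<Sum>i | x $ i > 0. real (x $ i) * ln (\<eta> $ i)))"

definition mPF :: "(real ^ 'n::finite) set \<Rightarrow> nat ^ 'n \<Rightarrow> 'n \<Rightarrow> real" where
  "mPF C x i =
     (if x $ i = 0 then 0 else exp (PF_potential C x - PF_potential C (x - axis i 1)))"

section \<open>Continuous-time Markov processes on a discrete state space\<close>

definition transition_function :: "(real \<Rightarrow> 's \<Rightarrow> 's pmf) \<Rightarrow> bool" where
  "transition_function P \<longleftrightarrow>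
     (\<forall>x. P 0 x = return_pmf x) \<and>
     (\<forall>s\<ge>0. \<forall>t\<ge>0. \<forall>x. P (s + t) x = bind_pmf (P s x) (P t))"

text \<open>
  \<open>q x y\<close> is the rate of jumps from \<open>x\<close> to \<open>y \<noteq> x\<close>. The second condition says that the
  total rate of leaving \<open>x\<close> is the sum of these, i.e. that the Q-matrix is stable and
  conservative; the values \<open>q x x\<close> are irrelevant.
\<close>

definition has_rates :: "(real \<Rightarrow> 's \<Rightarrow> 's pmf) \<Rightarrow> ('s \<Rightarrow> 's \<Rightarrow> real) \<Rightarrow> bool" where
  "has_rates P q \<longleftrightarrow>
     (\<forall>x y. x \<noteq> y \<longrightarrow> ((\<lambda>h. pmf (P h x) y / h) \<longlongrightarrow> q x y) (at_right 0)) \<and>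
     (\<forall>x. ((\<lambda>h. (1 - pmf (P h x) x) / h) \<longlongrightarrow> (\<Sum>\<^sub>\<infinity>y\<in>-{x}. q x y)) (at_right 0))"

text \<open>
  Markov property in elementary form: the past up to time \<open>s\<close> is observed at \<open>s\<close> and at
  finitely many earlier times \<open>T\<close>, with observed values \<open>\<xi>\<close>. The initial law is
  arbitrary, and no path regularity is required.
\<close>

definition markov_process ::
    "'w measure \<Rightarrow> (real \<Rightarrow> 'w \<Rightarrow> 's) \<Rightarrow> (real \<Rightarrow> 's \<Rightarrow> 's pmf) \<Rightarrow> bool" where
  "markov_process M X P \<longleftrightarrow>
     prob_space M \<and> transition_function P \<and>
     (\<forall>t\<ge>0. X t \<in> measurable M (count_space UNIV)) \<and>
     (\<forall>s u T \<xi> y. 0 \<le> s \<longrightarrow> s \<le> u \<longrightarrow> finite T \<longrightarrow> T \<subseteq> {0..s} \<longrightarrow>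
        \<P>(\<omega> in M. (\<forall>r\<in>insert s T. X r \<omega> = \<xi> r) \<and> X u \<omega> = y) =
        \<P>(\<omega> in M. \<forall>r\<in>insert s T. X r \<omega> = \<xi> r) * pmf (P (u - s) (\<xi> s)) y)"

definition stationary_distribution :: "(real \<Rightarrow> 's \<Rightarrow> 's pmf) \<Rightarrow> 's pmf \<Rightarrow> bool" where
  "stationary_distribution P \<pi> \<longleftrightarrow> (\<forall>t\<ge>0. bind_pmf \<pi> (P t) = \<pi>)"

section \<open>The process associated with an allocation\<close>

definition jump_rate ::
    "real ^ 'n::finite \<Rightarrow> (nat ^ 'n \<Rightarrow> 'n \<Rightarrow> real) \<Rightarrow> nat ^ 'n \<Rightarrow> nat ^ 'n \<Rightarrow> real" where
  "jump_rate lam \<phi> x y =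
     (\<Sum>i\<in>UNIV. (if y = x + axis i 1 then lam $ i else 0) +
                 (if x $ i > 0 \<and> y = x - axis i 1 then \<phi> x i else 0))"

text \<open>
  Where \<open>x\<^sub>i = 0\<close>, the subtraction \<open>x - axis i 1\<close> truncates to \<open>x\<close>, so the departure
  term vanishes, in accordance with \<open>\<phi> x i = 0\<close> there.
\<close>

definition generator ::
    "real ^ 'n::finite \<Rightarrow> (nat ^ 'n \<Rightarrow> 'n \<Rightarrow> real) \<Rightarrow> (nat ^ 'n \<Rightarrow> real) \<Rightarrow> nat ^ 'n \<Rightarrow> real" where
  "generator lam \<phi> f x =
     (\<Sum>i\<in>UNIV. lam $ i * (f (x + axis i 1) - f x) + \<phi> x i * (f (x - axis i 1) - f x))"

section \<open>The Lyapunov function\<close>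

definition lyap_F :: "real ^ 'n::finite \<Rightarrow> nat ^ 'n \<Rightarrow> real" where
  "lyap_F lam x = sqrt (\<Sum>i\<in>UNIV. (real (x $ i))\<^sup>2 / lam $ i)"

definition lyap_G :: "real ^ 'n::finite \<Rightarrow> real \<Rightarrow> nat ^ 'n \<Rightarrow> real" where
  "lyap_G lam \<delta> x = exp (\<delta> * lyap_F lam x)"

end

theory Submission
  imports Defs
begin

text \<open>
  Drift. Let \<open>\<eta>\<close> be an optimal allocation for \<open>x\<close>. To first order \<open>G\<close> changes at rate
  \<open>\<delta> G / F\<close> times \<open>\<Sum>\<^sub>i x\<^sub>i (1 - \<phi>\<^sub>i / \<lambda>\<^sub>i)\<close>, and everything else is of order \<open>\<delta>\<^sup>2 G\<close> or
  \<open>\<delta> G / F\<close>, so it suffices to bound this sum by \<open>B - c |x|\<close>. Two facts about optimal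
  allocations achieve this. The first-order condition \<open>\<Sum>\<^sub>i x\<^sub>i \<zeta>\<^sub>i / \<eta>\<^sub>i \<le> |x|\<close> for \<open>\<zeta> \<in> C\<close>
  (\<open>PF_first_order_condition\<close>), used with \<open>\<zeta> = (1 + \<epsilon>) \<lambda>\<close> and \<open>1 - u \<le> 1 / u - 1\<close>, gives
  \<open>\<Sum>\<^sub>i x\<^sub>i (1 - \<eta>\<^sub>i / \<lambda>\<^sub>i) \<le> - c |x|\<close>. Passing from \<open>\<eta>\<close> to \<open>\<phi>\<close> costs only a constant: adding the
  first-order conditions at \<open>x\<close> and at \<open>x - e\<^sub>i\<close> shows that the optimal share of class \<open>i\<close>
  changes by a factor of at most \<open>x\<^sub>i / (x\<^sub>i - 1)\<close> between the two states, whence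
  \<open>(x\<^sub>i - 1) \<eta>\<^sub>i \<le> x\<^sub>i \<phi>\<^sub>i\<close> (\<open>mPF_ge_optimal\<close>).

  Ergodicity. The transition function is given only through its derivatives at time 0, with
  no sample paths to stop. The backward equation together with a maximum principle on the
  space of states turns the drift into \<open>E\<^sub>x V(X\<^sub>t) \<le> e\<^sup>-\<^sup>\<gamma>\<^sup>t V(x) + b / \<gamma>\<close>
  (\<open>evolve_le_supersolution\<close>, \<open>expectation_lyapunov\<close>), where \<open>V = G\<close>. Outside a finite set of
  states this contracts \<open>V\<close>; inside it, two copies run independently for unit time meet at
  the origin with a probability bounded away from 0, because departures lead to the origin
  from every state. Both effects combine in the Hairer-Mattingly weighted distance
  \<open>2 + \<beta> (V(u) + V(v))\<close>, which shrinks by a fixed factor in each unit of time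
  (\<open>one_step_contraction\<close>). Hence the law at time \<open>t\<close> is Cauchy in total variation at an
  exponential rate; its limit is the stationary distribution.
\<close>

section \<open>Rates of the modified proportional fair allocation\<close>

text \<open>
  For allocations in the nonnegative orthant, the exponential of the objective \<open>\<Sum>\<^sub>i x\<^sub>i log \<eta>\<^sub>i\<close>. It vanishes exactly where the objective is
  \<open>-\<infinity>\<close>, so it is continuous on all of \<open>C\<close>, and compactness yields a maximiser at once.
\<close>

definition alloc_monomial :: "real ^ 'n::finite \<Rightarrow> nat ^ 'n \<Rightarrow> real" where
  "alloc_monomial \<eta> x = (\<Prod>i\<in>UNIV. (\<eta> $ i) ^ (x $ i))"

definition PF_optimal :: "(real ^ 'n::finite) set \<Rightarrow> nat ^ 'n \<Rightarrow> real ^ 'n \<Rightarrow> bool" where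
  "PF_optimal C x \<eta> \<longleftrightarrow> \<eta> \<in> C \<and> (\<forall>i. x $ i > 0 \<longrightarrow> \<eta> $ i > 0) \<and>
     (\<forall>\<zeta>\<in>C. alloc_monomial \<zeta> x \<le> alloc_monomial \<eta> x)"

lemma alloc_monomial_pos:
  "(\<And>i. x $ i > 0 \<Longrightarrow> \<eta> $ i > 0) \<Longrightarrow> alloc_monomial \<eta> x > 0"
  unfolding alloc_monomial_def
proof (intro prod_pos)
  fix i assume "\<And>i. x $ i > 0 \<Longrightarrow> \<eta> $ i > 0"
  then show "0 < (\<eta> $ i) ^ (x $ i)" by (cases "x $ i = 0") auto
qed

lemma ln_alloc_monomial:
  assumes "\<And>i. x $ i > 0 \<Longrightarrow> \<eta> $ i > 0"
  shows "ln (alloc_monomial \<eta> x) = (\<Sum>i | x $ i > 0. real (x $ i) * ln (\<eta> $ i))"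
proof -
  have "alloc_monomial \<eta> x = (\<Prod>i | x $ i > 0. (\<eta> $ i) ^ (x $ i))"
    unfolding alloc_monomial_def by (rule prod.mono_neutral_right) auto
  also have "ln \<dots> = (\<Sum>i | x $ i > 0. ln ((\<eta> $ i) ^ (x $ i)))"
  proof (rule ln_prod)
    fix i assume "i \<in> {i. x $ i > 0}"
    then have "\<eta> $ i > 0" using assms by simp
    then show "(\<eta> $ i) ^ (x $ i) \<noteq> 0" by simp
  qed simp
  finally show ?thesis
    using assms by (simp add: ln_realpow)
qed

lemma alloc_monomial_remove:
  assumes "x $ i > 0"
  shows "alloc_monomial \<eta> x = \<eta> $ i * alloc_monomial \<eta> (x - axis i 1)"
proof -
  have "(\<Prod>j\<in>UNIV - {i}. (\<eta> $ j) ^ ((x - axis i 1) $ j)) = (\<Prod>j\<in>UNIV - {i}. (\<eta> $ j) ^ (x $ j))"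
    by (intro prod.cong) (auto simp: axis_def)
  moreover have "(\<eta> $ i) ^ (x $ i) = \<eta> $ i * (\<eta> $ i) ^ ((x - axis i 1) $ i)"
    using assms by (simp add: axis_def power_eq_if)
  ultimately show ?thesis
    unfolding alloc_monomial_def by (simp add: prod.remove[where x=i])
qed

lemma capacity_set_pos_point:
  assumes "capacity_set C"
  obtains \<eta> where "\<eta> \<in> C" "\<And>i. \<eta> $ i > 0"
proof -
  obtain c where c: "c > 0" and sub: "{\<eta>. (\<forall>i. 0 \<le> \<eta> $ i) \<and> (\<Sum>i\<in>UNIV. \<eta> $ i) \<le> c} \<subseteq> C"
    using assms unfolding capacity_set_def by auto
  define \<eta> :: "real ^ 'a" where "\<eta> = (\<chi> i. c / real CARD('a))"
  have "\<eta> \<in> C" using c by (intro subsetD[OF sub]) (auto simp: \<eta>_def)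
  moreover have "\<eta> $ i > 0" for i using c by (simp add: \<eta>_def)
  ultimately show ?thesis using that by blast
qed

lemma PF_optimal_exists:
  assumes C: "capacity_set C"
  shows "\<exists>\<eta>. PF_optimal C x \<eta>"
proof -
  obtain p where p: "p \<in> C" "\<And>i. p $ i > 0" using capacity_set_pos_point[OF C] by blast
  have "compact C" "C \<noteq> {}" using C p unfolding capacity_set_def by auto
  moreover have "continuous_on C (\<lambda>\<eta>. alloc_monomial \<eta> x)"
    unfolding alloc_monomial_def by (intro continuous_intros)
  ultimately obtain \<eta> where \<eta>: "\<eta> \<in> C" "\<And>\<zeta>. \<zeta> \<in> C \<Longrightarrow> alloc_monomial \<zeta> x \<le> alloc_monomial \<eta> x"
    using continuous_attains_sup by meson
  have "alloc_monomial \<eta> x > 0"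
    using \<eta>(2)[OF p(1)] alloc_monomial_pos[of x p] p(2) by fastforce
  then have "\<eta> $ i \<noteq> 0" if "x $ i > 0" for i
    using that by (auto simp: alloc_monomial_remove)
  then have "\<forall>i. x $ i > 0 \<longrightarrow> \<eta> $ i > 0"
    using C \<eta>(1) unfolding capacity_set_def by (metis less_eq_real_def)
  with \<eta> show ?thesis unfolding PF_optimal_def by auto
qed

lemma exp_PF_potential:
  assumes opt: "PF_optimal C x \<eta>"
  shows "exp (PF_potential C x) = alloc_monomial \<eta> x"
proof (cases "x = 0")
  case True
  then show ?thesis by (simp add: PF_potential_def alloc_monomial_def)
next
  case False
  let ?S = "{\<zeta>\<in>C. \<forall>i. x $ i > 0 \<longrightarrow> \<zeta> $ i > 0}"
  let ?f = "\<lambda>\<zeta>. \<Sum>i | x $ i > 0. real (x $ i) * ln (\<zeta> $ i)"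
  have \<eta>: "\<eta> \<in> ?S" using opt unfolding PF_optimal_def by auto
  have "?f \<zeta> \<le> ?f \<eta>" if "\<zeta> \<in> ?S" for \<zeta>
  proof -
    have "ln (alloc_monomial \<zeta> x) \<le> ln (alloc_monomial \<eta> x)"
      using that opt alloc_monomial_pos[of x \<zeta>] by (intro ln_mono) (auto simp: PF_optimal_def)
    then show ?thesis using that \<eta> by (simp add: ln_alloc_monomial)
  qed
  then have "Sup (?f ` ?S) = ?f \<eta>"
    using \<eta> by (intro cSup_eq_maximum) auto
  then have "PF_potential C x = ln (alloc_monomial \<eta> x)"
    using False \<eta> by (simp add: PF_potential_def ln_alloc_monomial)
  then show ?thesis using alloc_monomial_pos[of x \<eta>] \<eta> by simp
qed

text \<open>
  Along the segment from \<open>\<eta>\<close> to \<open>\<zeta>\<close> the objective has right derivative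
  \<open>\<Sum>\<^sub>i x\<^sub>i (\<zeta>\<^sub>i - \<eta>\<^sub>i) / \<eta>\<^sub>i\<close> at \<open>\<eta>\<close>, which cannot be positive at a maximiser. Coordinates with
  \<open>x\<^sub>i = 0\<close>, where \<open>\<eta>\<^sub>i\<close> may be 0, contribute 0 to both sums.
\<close>

lemma PF_first_order_condition:
  assumes C: "capacity_set C" and opt: "PF_optimal C x \<eta>" and \<zeta>: "\<zeta> \<in> C"
  shows "(\<Sum>i\<in>UNIV. real (x $ i) * (\<zeta> $ i / \<eta> $ i)) \<le> (\<Sum>i\<in>UNIV. real (x $ i))"
proof -
  let ?p = "\<lambda>\<theta>. (1 - \<theta>) *\<^sub>R \<eta> + \<theta> *\<^sub>R \<zeta>"
  define f where "f \<theta> = (\<Sum>i | x $ i > 0. real (x $ i) * ln (?p \<theta> $ i))" for \<theta>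
  define D where "D = (\<Sum>i | x $ i > 0. real (x $ i) * ((\<zeta> $ i - \<eta> $ i) / \<eta> $ i))"
  have \<eta>: "\<eta> \<in> C" "\<And>i. x $ i > 0 \<Longrightarrow> \<eta> $ i > 0"
    "\<And>\<zeta>. \<zeta> \<in> C \<Longrightarrow> alloc_monomial \<zeta> x \<le> alloc_monomial \<eta> x"
    using opt unfolding PF_optimal_def by auto
  have nn: "\<zeta> $ i \<ge> 0" for i using C \<zeta> unfolding capacity_set_def by auto
  have der: "DERIV f 0 :> D"
    unfolding f_def D_def
    by (auto intro!: derivative_eq_intros sum.cong simp: \<eta>(2) divide_simps)
  have "D \<le> 0"
  proof (rule ccontr)
    assume "\<not> D \<le> 0"
    then obtain d where d: "d > 0" "\<And>h. 0 < h \<Longrightarrow> h < d \<Longrightarrow> f 0 < f (0 + h)"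
      using DERIV_pos_inc_right[OF der] by auto
    define h where "h = min (d / 2) (1 / 2)"
    have h: "0 < h" "h < 1" "h < d" using d(1) by (auto simp: h_def)
    have pC: "?p h \<in> C"
      using C \<eta>(1) \<zeta> h unfolding capacity_set_def by (auto simp: convex_def)
    have ppos: "?p h $ i > 0" if "x $ i > 0" for i
      using \<eta>(2)[OF that] nn[of i] h by (simp add: add_pos_nonneg)
    have "f h = ln (alloc_monomial (?p h) x)"
      unfolding f_def using ln_alloc_monomial[OF ppos, of x] by simp
    also have "\<dots> \<le> ln (alloc_monomial \<eta> x)"
      using \<eta>(3)[OF pC] alloc_monomial_pos[OF ppos, of x] by simp
    also have "\<dots> = f 0"
      unfolding f_def using ln_alloc_monomial[OF \<eta>(2), of x] by simp
    finally show False using d(2)[of h] h by simp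
  qed
  have "(\<Sum>i\<in>UNIV. real (x $ i) * (\<zeta> $ i / \<eta> $ i)) - (\<Sum>i\<in>UNIV. real (x $ i))
      = (\<Sum>i\<in>UNIV. real (x $ i) * (\<zeta> $ i / \<eta> $ i - 1))"
    by (simp add: sum_subtractf algebra_simps)
  also have "\<dots> = (\<Sum>i | x $ i > 0. real (x $ i) * (\<zeta> $ i / \<eta> $ i - 1))"
    by (rule sum.mono_neutral_right) auto
  also have "\<dots> = D"
    unfolding D_def
  proof (intro sum.cong refl)
    fix i assume "i \<in> {i. x $ i > 0}"
    then have "\<eta> $ i \<noteq> 0" using \<eta>(2)[of i] by simp
    then show "real (x $ i) * (\<zeta> $ i / \<eta> $ i - 1) = real (x $ i) * ((\<zeta> $ i - \<eta> $ i) / \<eta> $ i)"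
      by (simp add: diff_divide_distrib)
  qed
  finally show ?thesis using \<open>D \<le> 0\<close> by simp
qed

text \<open>
  The rate is the quotient of the maxima of the monomials at \<open>x\<close> and \<open>x - e\<^sub>i\<close>, and these
  monomials differ by the factor \<open>\<eta>\<^sub>i\<close>. Inserting the optimal allocation for one state into the
  maximum for the other encloses the rate between the two optimal shares of class \<open>i\<close>.
\<close>

lemma mPF_le_optimal:
  assumes C: "capacity_set C" and opt: "PF_optimal C x \<eta>" and i: "x $ i > 0"
  shows "mPF C x i \<le> \<eta> $ i"
proof -
  obtain \<eta>' where opt': "PF_optimal C (x - axis i 1) \<eta>'" using PF_optimal_exists[OF C] by blast
  have pos: "alloc_monomial \<eta>' (x - axis i 1) > 0"
    using opt' by (intro alloc_monomial_pos) (auto simp: PF_optimal_def)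
  have "mPF C x i = alloc_monomial \<eta> x / alloc_monomial \<eta>' (x - axis i 1)"
    using i by (simp add: mPF_def exp_diff exp_PF_potential[OF opt] exp_PF_potential[OF opt'] del: One_nat_def)
  also have "\<dots> = \<eta> $ i * (alloc_monomial \<eta> (x - axis i 1) / alloc_monomial \<eta>' (x - axis i 1))"
    by (simp add: alloc_monomial_remove[OF i])
  also have "\<dots> \<le> \<eta> $ i * 1"
    using opt opt' pos i by (intro mult_left_mono) (auto simp: PF_optimal_def less_imp_le)
  finally show ?thesis by simp
qed

lemma optimal_le_mPF:
  assumes C: "capacity_set C" and opt': "PF_optimal C (x - axis i 1) \<eta>'" and i: "x $ i > 0"
  shows "\<eta>' $ i \<le> mPF C x i"
proof -
  obtain \<eta> where opt: "PF_optimal C x \<eta>" using PF_optimal_exists[OF C] by blast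
  have pos: "alloc_monomial \<eta>' (x - axis i 1) > 0"
    using opt' by (intro alloc_monomial_pos) (auto simp: PF_optimal_def)
  have "\<eta>' $ i = alloc_monomial \<eta>' x / alloc_monomial \<eta>' (x - axis i 1)"
    using pos by (simp add: alloc_monomial_remove[OF i])
  also have "\<dots> \<le> alloc_monomial \<eta> x / alloc_monomial \<eta>' (x - axis i 1)"
    using opt opt' pos by (intro divide_right_mono) (auto simp: PF_optimal_def)
  also have "\<dots> = mPF C x i"
    using i by (simp add: mPF_def exp_diff exp_PF_potential[OF opt] exp_PF_potential[OF opt'] del: One_nat_def)
  finally show ?thesis .
qed

lemma sum_ratio_ge_two:
  fixes r :: real assumes "r > 0" shows "r + 1 / r \<ge> 2"
proof -
  have "r + 1 / r - 2 = (r - 1)\<^sup>2 / r" using assms by (simp add: field_simps power2_eq_square)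
  also have "\<dots> \<ge> 0" using assms by simp
  finally show ?thesis by simp
qed

text \<open>
  The first-order conditions at \<open>x\<close> and at \<open>y = x - e\<^sub>i\<close>, each tested with the optimum of the
  other state, add up to \<open>\<Sum>\<^sub>j y\<^sub>j (r\<^sub>j + 1 / r\<^sub>j - 2) + 1 / r\<^sub>i - 1 \<le> 0\<close> with
  \<open>r\<^sub>j = \<eta>\<^sub>j / \<eta>'\<^sub>j\<close>. Every term of the sum is nonnegative; keeping only \<open>j = i\<close> gives
  \<open>y\<^sub>i (r\<^sub>i - 1)\<^sup>2 \<le> r\<^sub>i - 1\<close>, hence \<open>r\<^sub>i \<le> 1 + 1 / y\<^sub>i\<close>.
\<close>

lemma optimal_stability:
  assumes C: "capacity_set C" and opt: "PF_optimal C x \<eta>"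
    and opt': "PF_optimal C (x - axis i 1) \<eta>'" and i: "x $ i > 1"
  shows "real (x $ i - 1) * \<eta> $ i \<le> real (x $ i) * \<eta>' $ i"
proof -
  define y where "y = x - axis i 1"
  define k where "k = real (y $ i)"
  define r where "r = \<eta> $ i / \<eta>' $ i"
  have xi: "real (x $ i) = k + 1" using i by (simp add: k_def y_def axis_def)
  have k: "k \<ge> 1" using i by (simp add: k_def y_def axis_def)
  have \<eta>: "\<eta> \<in> C" "\<And>j. x $ j > 0 \<Longrightarrow> \<eta> $ j > 0" using opt unfolding PF_optimal_def by auto
  have \<eta>': "\<eta>' \<in> C" "\<And>j. y $ j > 0 \<Longrightarrow> \<eta>' $ j > 0"
    using opt' unfolding PF_optimal_def y_def by auto
  have yx: "x $ j > 0" if "y $ j > 0" for j using that by (auto simp: y_def)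
  have pos: "\<eta> $ i > 0" "\<eta>' $ i > 0" using \<eta>(2) \<eta>'(2)[of i] i k by (auto simp: k_def)
  have x: "real (x $ j) = real (y $ j) + (if j = i then 1 else 0)" for j
    using i by (auto simp: y_def axis_def)
  have a: "(\<Sum>j\<in>UNIV. real (x $ j) * (\<eta>' $ j / \<eta> $ j)) \<le> (\<Sum>j\<in>UNIV. real (x $ j))"
    by (rule PF_first_order_condition[OF C opt \<eta>'(1)])
  have b: "(\<Sum>j\<in>UNIV. real (y $ j) * (\<eta> $ j / \<eta>' $ j)) \<le> (\<Sum>j\<in>UNIV. real (y $ j))"
    using PF_first_order_condition[OF C opt' \<eta>(1)] unfolding y_def .
  have a': "(\<Sum>j\<in>UNIV. real (y $ j) * (\<eta>' $ j / \<eta> $ j)) + \<eta>' $ i / \<eta> $ i \<le> (\<Sum>j\<in>UNIV. real (y $ j)) + 1"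
  proof -
    have "(\<Sum>j\<in>UNIV. real (x $ j) * (\<eta>' $ j / \<eta> $ j))
        = (\<Sum>j\<in>UNIV. real (y $ j) * (\<eta>' $ j / \<eta> $ j) + (if j = i then \<eta>' $ i / \<eta> $ i else 0))"
      by (rule sum.cong) (auto simp: x algebra_simps add_divide_distrib)
    then show ?thesis using a by (simp add: x sum.distrib)
  qed
  let ?g = "\<lambda>j. real (y $ j) * (\<eta> $ j / \<eta>' $ j + \<eta>' $ j / \<eta> $ j - 2)"
  have "?g j \<ge> 0" for j
  proof (cases "y $ j > 0")
    case True
    then have "\<eta> $ j / \<eta>' $ j > 0" using \<eta>(2)[OF yx] \<eta>'(2) by simp
    then show ?thesis using sum_ratio_ge_two[of "\<eta> $ j / \<eta>' $ j"] by simp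
  qed simp
  then have "?g i \<le> sum ?g UNIV" by (intro member_le_sum) auto
  also have "\<dots> = (\<Sum>j\<in>UNIV. real (y $ j) * (\<eta>' $ j / \<eta> $ j)) + (\<Sum>j\<in>UNIV. real (y $ j) * (\<eta> $ j / \<eta>' $ j))
      - 2 * (\<Sum>j\<in>UNIV. real (y $ j))"
    by (simp add: algebra_simps sum.distrib sum_subtractf sum_distrib_left)
  also have "\<dots> \<le> 1 - \<eta>' $ i / \<eta> $ i" using a' b by simp
  finally have "k * (r + 1 / r - 2) \<le> 1 - 1 / r" by (simp add: k_def r_def)
  moreover have r: "r > 0" using pos by (simp add: r_def)
  ultimately have "r * (k * (r + 1 / r - 2)) \<le> r * (1 - 1 / r)"
    by (intro mult_left_mono) auto
  moreover have "r * (k * (r + 1 / r - 2)) = k * (r - 1)\<^sup>2"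
    using r by (simp add: field_simps power2_eq_square)
  moreover have "r * (1 - 1 / r) = r - 1" using r by (simp add: field_simps)
  ultimately have le: "k * (r - 1)\<^sup>2 \<le> r - 1" by simp
  have "k * (r - 1) \<le> 1"
  proof (cases "r > 1")
    case True
    have "(k * (r - 1)) * (r - 1) \<le> 1 * (r - 1)" using le by (simp add: power2_eq_square mult.assoc)
    then show ?thesis using True mult_le_cancel_right_pos[of "r - 1"] by simp
  next
    case False
    then have "k * (r - 1) \<le> 0" using k by (simp add: mult_nonneg_nonpos)
    then show ?thesis by simp
  qed
  then have "k * r \<le> k + 1" by (simp add: algebra_simps)
  then have "k * \<eta> $ i \<le> (k + 1) * \<eta>' $ i" using pos by (simp add: r_def field_simps)
  then show ?thesis using xi i by (simp add: of_nat_diff)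
qed

text \<open>
  The form with the factor \<open>x\<^sub>i - 1\<close> also covers \<open>x\<^sub>i \<le> 1\<close>, where it is trivial, and it is
  what the drift needs: summed over the classes, the loss against \<open>\<eta>\<close> stays bounded.
\<close>

lemma mPF_ge_optimal:
  assumes C: "capacity_set C" and opt: "PF_optimal C x \<eta>"
  shows "(real (x $ i) - 1) * \<eta> $ i \<le> real (x $ i) * mPF C x i"
proof (cases "x $ i > 1")
  case True
  obtain \<eta>' where opt': "PF_optimal C (x - axis i 1) \<eta>'" using PF_optimal_exists[OF C] by blast
  have "(real (x $ i) - 1) * \<eta> $ i \<le> real (x $ i) * \<eta>' $ i"
    using optimal_stability[OF C opt opt' True] True by (simp add: of_nat_diff)
  also have "\<dots> \<le> real (x $ i) * mPF C x i"
    using optimal_le_mPF[OF C opt'] True by (intro mult_left_mono) auto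
  finally show ?thesis .
next
  case False
  have "\<eta> $ i \<ge> 0" using C opt unfolding capacity_set_def PF_optimal_def by auto
  then have "(real (x $ i) - 1) * \<eta> $ i \<le> 0" using False by (intro mult_nonpos_nonneg) auto
  also have "0 \<le> real (x $ i) * mPF C x i" by (simp add: mPF_def)
  finally show ?thesis .
qed

lemma interior_capacity_set:
  assumes C: "capacity_set C" and lam: "lam \<in> interior C"
  shows "lam $ i > 0" and "\<exists>\<epsilon>>0. (1 + \<epsilon>) *\<^sub>R lam \<in> C"
proof -
  obtain e where e: "e > 0" "ball lam e \<subseteq> C" using lam mem_interior by blast
  have "lam - axis i (e / 2) \<in> C"
  proof (intro subsetD[OF e(2)])
    have "norm (axis i (e / 2)) \<le> (\<Sum>j\<in>UNIV. \<bar>axis i (e / 2) $ j\<bar>)" by (rule norm_le_l1_cart)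
    also have "\<dots> = (\<Sum>j\<in>UNIV. if j = i then e / 2 else 0)"
      using e by (intro sum.cong) (auto simp: axis_def)
    finally show "lam - axis i (e / 2) \<in> ball lam e" using e by (simp add: dist_norm)
  qed
  then have "(lam - axis i (e / 2)) $ i \<ge> 0" using C unfolding capacity_set_def by blast
  then show "lam $ i > 0" using e by (simp add: axis_def)
  define \<epsilon> where "\<epsilon> = e / (2 * (norm lam + 1))"
  have n: "norm lam + 1 > 0" by (simp add: add_nonneg_pos)
  have \<epsilon>: "\<epsilon> > 0" unfolding \<epsilon>_def using e n by simp
  have "\<epsilon> * norm lam \<le> \<epsilon> * (norm lam + 1)" using \<epsilon> by simp
  also have "\<dots> = e / 2" using n by (simp add: \<epsilon>_def field_simps)
  finally have "\<epsilon> * norm lam < e" using e by simp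
  then have "(1 + \<epsilon>) *\<^sub>R lam \<in> ball lam e"
    using \<epsilon> by (simp add: dist_norm algebra_simps)
  then show "\<exists>\<epsilon>>0. (1 + \<epsilon>) *\<^sub>R lam \<in> C" using e \<epsilon> by blast
qed

text \<open>
  One constant \<open>B\<close> serves as the bound on the rates and as the additive constant in the drift.
  The optimal share \<open>\<eta>\<close> satisfies \<open>\<Sum>\<^sub>i x\<^sub>i (1 - \<eta>\<^sub>i / \<lambda>\<^sub>i) \<le> - c |x|\<close> because \<open>(1 + \<epsilon>) \<lambda>\<close> still
  lies in \<open>C\<close>, and replacing \<open>\<eta>\<close> by \<open>\<phi>\<close> raises the sum by at most a constant.
\<close>

lemma mPF_drift:
  assumes C: "capacity_set C" and lam: "lam \<in> interior C"
  shows "\<exists>B c. 0 < c \<and> (\<forall>x i. 0 \<le> mPF C x i \<and> mPF C x i \<le> B) \<and>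
    (\<forall>x. (\<Sum>i\<in>UNIV. real (x $ i) * (1 - mPF C x i / lam $ i)) \<le> B - c * real (\<Sum>i\<in>UNIV. x $ i))"
proof -
  note lpos = interior_capacity_set(1)[OF C lam]
  obtain \<epsilon> where \<epsilon>: "\<epsilon> > 0" "(1 + \<epsilon>) *\<^sub>R lam \<in> C" using interior_capacity_set(2)[OF C lam] by blast
  obtain b where b: "\<And>\<eta>. \<eta> \<in> C \<Longrightarrow> norm \<eta> \<le> b"
    using C compact_imp_bounded bounded_iff unfolding capacity_set_def by metis
  have b': "\<eta> $ i \<le> b" if "\<eta> \<in> C" for \<eta> i
    using b[OF that] component_le_norm_cart[of \<eta> i] by linarith
  have b0: "b \<ge> 0" using b[OF \<epsilon>(2)] norm_ge_zero order_trans by blast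
  define B where "B = b + (\<Sum>i\<in>UNIV. b / lam $ i)"
  define c where "c = \<epsilon> / (1 + \<epsilon>)"
  have s0: "(\<Sum>i\<in>UNIV. b / lam $ i) \<ge> 0" using b0 lpos by (intro sum_nonneg) (simp add: less_imp_le)
  have "0 \<le> mPF C x i \<and> mPF C x i \<le> B" for x i
  proof (cases "x $ i > 0")
    case True
    obtain \<eta> where opt: "PF_optimal C x \<eta>" using PF_optimal_exists[OF C] by blast
    then have "\<eta> \<in> C" by (simp add: PF_optimal_def)
    with mPF_le_optimal[OF C opt True] b'[of \<eta> i] s0 show ?thesis by (auto simp: mPF_def B_def)
  qed (use b0 s0 in \<open>simp add: mPF_def B_def\<close>)
  moreover have "(\<Sum>i\<in>UNIV. real (x $ i) * (1 - mPF C x i / lam $ i)) \<le> B - c * real (\<Sum>i\<in>UNIV. x $ i)" for x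
  proof -
    obtain \<eta> where opt: "PF_optimal C x \<eta>" using PF_optimal_exists[OF C] by blast
    then have \<eta>: "\<eta> \<in> C" "\<And>i. x $ i > 0 \<Longrightarrow> \<eta> $ i > 0" by (auto simp: PF_optimal_def)
    have step: "real (x $ i) * (1 - mPF C x i / lam $ i)
        \<le> b / lam $ i + real (x $ i) * (lam $ i / \<eta> $ i - 1)" for i
    proof -
      have "(real (x $ i) - 1) * \<eta> $ i / lam $ i \<le> real (x $ i) * mPF C x i / lam $ i"
        using mPF_ge_optimal[OF C opt] lpos by (intro divide_right_mono) (auto simp: less_imp_le)
      moreover have "\<eta> $ i / lam $ i \<le> b / lam $ i"
        using b'[OF \<eta>(1)] lpos by (intro divide_right_mono) (auto simp: less_imp_le)
      moreover have "real (x $ i) * (2 - \<eta> $ i / lam $ i) \<le> real (x $ i) * (lam $ i / \<eta> $ i)"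
      proof (cases "x $ i > 0")
        case True
        then have "\<eta> $ i / lam $ i > 0" using \<eta>(2) lpos by simp
        then show ?thesis using sum_ratio_ge_two[of "\<eta> $ i / lam $ i"] by (intro mult_left_mono) auto
      qed simp
      ultimately show ?thesis by (simp add: algebra_simps diff_divide_distrib)
    qed
    have "(1 + \<epsilon>) * (\<Sum>i\<in>UNIV. real (x $ i) * (lam $ i / \<eta> $ i)) \<le> (\<Sum>i\<in>UNIV. real (x $ i))"
      using PF_first_order_condition[OF C opt \<epsilon>(2)] by (simp add: sum_distrib_left mult_ac)
    then have foc: "(\<Sum>i\<in>UNIV. real (x $ i) * (lam $ i / \<eta> $ i)) \<le> (1 - c) * (\<Sum>i\<in>UNIV. real (x $ i))"
      using \<epsilon>(1) by (simp add: c_def field_simps)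
    have "(\<Sum>i\<in>UNIV. real (x $ i) * (1 - mPF C x i / lam $ i))
        \<le> (\<Sum>i\<in>UNIV. b / lam $ i + real (x $ i) * (lam $ i / \<eta> $ i - 1))"
      by (intro sum_mono step)
    also have "\<dots> = (\<Sum>i\<in>UNIV. b / lam $ i) + (\<Sum>i\<in>UNIV. real (x $ i) * (lam $ i / \<eta> $ i)) - (\<Sum>i\<in>UNIV. real (x $ i))"
      by (simp add: sum.distrib sum_subtractf right_diff_distrib)
    also have "\<dots> \<le> B - c * (\<Sum>i\<in>UNIV. real (x $ i))"
      using foc b0 by (simp add: B_def algebra_simps)
    finally show ?thesis by simp
  qed
  moreover have "c > 0" using \<epsilon> by (simp add: c_def)
  ultimately show ?thesis by blast
qed

section \<open>Drift of the exponential Lyapunov function\<close>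

lemma exp_le_quadratic:
  fixes z :: real
  assumes "\<bar>z\<bar> \<le> 1"
  shows "exp z \<le> 1 + z + z\<^sup>2"
proof (cases "z \<ge> 0")
  case True
  then show ?thesis using assms exp_bound by simp
next
  case False
  have "1 \<le> (1 + z + z\<^sup>2) * (1 - z)"
  proof -
    have "(1 + z + z\<^sup>2) * (1 - z) = 1 - z * z\<^sup>2" by (simp add: algebra_simps power2_eq_square)
    moreover have "z * z\<^sup>2 \<le> 0" using False by (intro mult_nonpos_nonneg) auto
    ultimately show ?thesis by linarith
  qed
  moreover have "(1 + z + z\<^sup>2) * (1 - z) \<le> (1 + z + z\<^sup>2) * exp (- z)"
    using exp_ge_add_one_self[of "- z"] False assms by (intro mult_left_mono) (auto simp: power2_eq_square)
  ultimately have "1 \<le> (1 + z + z\<^sup>2) * exp (- z)" by linarith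
  then show ?thesis by (simp add: exp_minus field_simps)
qed

lemma lyap_F_L2_set:
  assumes "\<And>i. lam $ i > 0"
  shows "lyap_F lam x = L2_set (\<lambda>i. real (x $ i) / sqrt (lam $ i)) UNIV"
  using assms by (simp add: lyap_F_def L2_set_def power_divide less_imp_le)

lemma component_le_lyap_F:
  assumes "\<And>i. lam $ i > 0"
  shows "real (x $ i) \<le> sqrt (lam $ i) * lyap_F lam x"
proof -
  have "real (x $ i) / sqrt (lam $ i) \<le> lyap_F lam x"
    unfolding lyap_F_L2_set[OF assms]
    by (rule member_le_L2_set) auto
  then show ?thesis using assms[of i] by (simp add: field_simps)
qed

lemma lyap_F_ge_sum:
  assumes "\<And>i. lam $ i > 0"
  shows "real (\<Sum>i\<in>UNIV. x $ i) \<le> (\<Sum>i\<in>UNIV. sqrt (lam $ i)) * lyap_F lam x"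
  using sum_mono[of UNIV "\<lambda>i. real (x $ i)" "\<lambda>i. sqrt (lam $ i) * lyap_F lam x"]
    component_le_lyap_F[OF assms]
  by (simp add: sum_distrib_right)

lemma lyap_F_le_sum:
  assumes "\<And>i. lam $ i > 0"
  shows "lyap_F lam x \<le> (\<Sum>i\<in>UNIV. 1 / sqrt (lam $ i)) * real (\<Sum>i\<in>UNIV. x $ i)"
proof -
  have "lyap_F lam x \<le> (\<Sum>i\<in>UNIV. real (x $ i) / sqrt (lam $ i))"
    unfolding lyap_F_L2_set[OF assms]
    by (rule L2_set_le_sum) (use assms in \<open>auto simp: less_imp_le\<close>)
  also have "\<dots> \<le> (\<Sum>i\<in>UNIV. (1 / sqrt (lam $ i)) * real (\<Sum>i\<in>UNIV. x $ i))"
  proof (rule sum_mono)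
    fix i
    have "x $ i \<le> (\<Sum>i\<in>UNIV. x $ i)" by (rule member_le_sum) auto
    then have "real (x $ i) / sqrt (lam $ i) \<le> real (\<Sum>i\<in>UNIV. x $ i) / sqrt (lam $ i)"
      using assms[of i] by (intro divide_right_mono) (auto simp del: of_nat_sum)
    then show "real (x $ i) / sqrt (lam $ i) \<le> (1 / sqrt (lam $ i)) * real (\<Sum>i\<in>UNIV. x $ i)"
      by simp
  qed
  finally show ?thesis by (simp add: sum_distrib_right)
qed

text \<open>
  The tangent bound for the concave square root. As \<open>s\<close> may be negative, it serves upward and
  downward jumps alike.
\<close>

lemma sqrt_add_le:
  fixes a s :: real
  assumes "a > 0" "a\<^sup>2 + s \<ge> 0"
  shows "sqrt (a\<^sup>2 + s) \<le> a + s / (2 * a)"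
proof (rule real_le_lsqrt)
  have "(a + s / (2 * a))\<^sup>2 = a\<^sup>2 + s + (s / (2 * a))\<^sup>2"
    using assms by (simp add: power2_sum)
  then show "a\<^sup>2 + s \<le> (a + s / (2 * a))\<^sup>2" by simp
  have "a + s / (2 * a) = ((a\<^sup>2 + s) + a\<^sup>2) / (2 * a)"
    using assms by (simp add: field_simps power2_eq_square)
  also have "\<dots> \<ge> 0" using assms by (intro divide_nonneg_pos add_nonneg_nonneg[OF assms(2)]) simp_all
  finally show "a + s / (2 * a) \<ge> 0" .
qed

lemma lyap_F_sq:
  assumes "\<And>i. lam $ i > 0"
  shows "(lyap_F lam x)\<^sup>2 = (\<Sum>i\<in>UNIV. (real (x $ i))\<^sup>2 / lam $ i)"
  unfolding lyap_F_def using assms by (simp add: sum_nonneg less_imp_le)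

lemma lyap_F_change:
  assumes lam: "\<And>i. lam $ i > 0" and a: "lyap_F lam x > 0"
    and y: "\<And>j. j \<noteq> i \<Longrightarrow> y $ j = x $ j" and yi: "real (y $ i) = real (x $ i) + s"
  shows "lyap_F lam y - lyap_F lam x \<le> (2 * s * real (x $ i) + s\<^sup>2) / (2 * lam $ i * lyap_F lam x)"
proof -
  let ?a = "lyap_F lam x"
  define t where "t = (2 * s * real (x $ i) + s\<^sup>2) / lam $ i"
  have "(\<Sum>j\<in>UNIV. (real (y $ j))\<^sup>2 / lam $ j) = (\<Sum>j\<in>UNIV. (real (x $ j))\<^sup>2 / lam $ j + (if j = i then t else 0))"
    by (rule sum.cong) (auto simp: y yi t_def power2_sum add_divide_distrib algebra_simps)
  also have "\<dots> = ?a\<^sup>2 + t" by (simp add: sum.distrib lyap_F_sq[OF lam])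
  finally have sq: "(lyap_F lam y)\<^sup>2 = ?a\<^sup>2 + t" using lyap_F_sq[OF lam, of y] by simp
  have "lyap_F lam y = sqrt (?a\<^sup>2 + t)"
    using sq[symmetric] by (simp add: lyap_F_def sum_nonneg lam less_imp_le)
  also have "\<dots> \<le> ?a + t / (2 * ?a)"
    using sq[symmetric] a by (intro sqrt_add_le) auto
  finally show ?thesis by (simp add: t_def)
qed

text \<open>
  A jump \<open>s = \<plusminus>1\<close> in class \<open>i\<close> changes \<open>F\<close> by at most its linearisation, which is bounded by \<open>H\<close>
  in absolute value since \<open>x\<^sub>i \<le> \<surd>\<lambda>\<^sub>i F(x)\<close>. Hence \<open>\<delta> H \<le> 1\<close> puts the exponent in the range
  where \<open>e\<^sup>z \<le> 1 + z + z\<^sup>2\<close>, and the error is quadratic in \<open>\<delta>\<close>.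
\<close>

lemma lyap_G_change:
  assumes lam: "\<And>i. lam $ i > 0" and a: "lyap_F lam x \<ge> 1" and \<delta>: "\<delta> > 0" "\<delta> * H \<le> 1"
    and H: "1 / sqrt (lam $ i) + 1 / lam $ i \<le> H" and s: "\<bar>s\<bar> = 1"
    and y: "\<And>j. j \<noteq> i \<Longrightarrow> y $ j = x $ j" and yi: "real (y $ i) = real (x $ i) + s"
  shows "lyap_G lam \<delta> y - lyap_G lam \<delta> x \<le>
    lyap_G lam \<delta> x * (\<delta> * ((2 * s * real (x $ i) + 1) / (2 * lam $ i * lyap_F lam x)) + \<delta>\<^sup>2 * H\<^sup>2)"
proof -
  let ?a = "lyap_F lam x"
  define h where "h = (2 * s * real (x $ i) + 1) / (2 * lam $ i * ?a)"
  have s2: "s\<^sup>2 = 1" using s by (simp add: abs_square_eq_1)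
  have hF: "lyap_F lam y - ?a \<le> h"
    using lyap_F_change[OF lam _ y yi] a s2 by (simp add: h_def)
  have "\<bar>h\<bar> = \<bar>2 * s * real (x $ i) + 1\<bar> / (2 * lam $ i * ?a)"
    using a lam[of i] by (simp add: h_def)
  also have "\<dots> \<le> (2 * (sqrt (lam $ i) * ?a) + 2 * ?a) / (2 * lam $ i * ?a)"
  proof (rule divide_right_mono)
    have "\<bar>2 * s * real (x $ i) + 1\<bar> \<le> 2 * real (x $ i) + 1"
      using s abs_triangle_ineq[of "2 * s * real (x $ i)" 1] by (simp add: abs_mult)
    also have "\<dots> \<le> 2 * (sqrt (lam $ i) * ?a) + 2 * ?a"
      using component_le_lyap_F[OF lam, of x i] a by linarith
    finally show "\<bar>2 * s * real (x $ i) + 1\<bar> \<le> 2 * (sqrt (lam $ i) * ?a) + 2 * ?a" .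
  qed (use a lam[of i] in auto)
  also have "\<dots> = sqrt (lam $ i) / lam $ i + 1 / lam $ i"
    using a lam[of i] by (simp add: add_divide_distrib)
  also have "\<dots> = 1 / sqrt (lam $ i) + 1 / lam $ i"
    using lam[of i] by (simp add: real_sqrt_divide field_simps)
  also note H
  finally have hH: "\<bar>h\<bar> \<le> H" .
  have "\<bar>\<delta> * h\<bar> \<le> 1"
    using mult_left_mono[OF hH, of \<delta>] \<delta> by (simp only: abs_mult) linarith
  then have e: "exp (\<delta> * h) \<le> 1 + \<delta> * h + \<delta>\<^sup>2 * h\<^sup>2"
    using exp_le_quadratic[of "\<delta> * h"] by (simp add: power_mult_distrib)
  have h2: "\<delta>\<^sup>2 * h\<^sup>2 \<le> \<delta>\<^sup>2 * H\<^sup>2"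
    using hH by (intro mult_left_mono) (auto simp: abs_le_square_iff[symmetric])
  have "lyap_G lam \<delta> y \<le> lyap_G lam \<delta> x * exp (\<delta> * h)"
    using hF \<delta> mult_left_mono[OF hF, of \<delta>]
    by (simp add: lyap_G_def exp_add[symmetric] algebra_simps)
  also have "\<dots> \<le> lyap_G lam \<delta> x * (1 + \<delta> * h + \<delta>\<^sup>2 * H\<^sup>2)"
    using e h2 by (intro mult_left_mono) (auto simp: lyap_G_def)
  finally show ?thesis by (simp add: h_def algebra_simps)
qed

text \<open>
  The first-order part is at most \<open>\<delta> / F\<close> times \<open>B + B2 - c |x|\<close>, which is at most \<open>- 2 \<gamma>\<close> for
  large \<open>|x|\<close> since \<open>F \<le> A |x|\<close>; the second-order part is at most \<open>\<delta>\<^sup>2 B3\<close>, which is at most \<open>\<gamma>\<close>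
  when \<open>\<delta> \<le> c / (4 A B3)\<close>.
\<close>

lemma lyap_G_drift:
  fixes lam :: "real ^ 'n::finite" and \<phi> :: "nat ^ 'n \<Rightarrow> 'n \<Rightarrow> real"
  assumes lam: "\<And>i. lam $ i > 0"
    and zero: "\<And>x i. x $ i = 0 \<Longrightarrow> \<phi> x i = 0"
    and bnd: "\<And>x i. 0 \<le> \<phi> x i \<and> \<phi> x i \<le> B" and c: "c > 0"
    and drift: "\<And>x. (\<Sum>i\<in>UNIV. real (x $ i) * (1 - \<phi> x i / lam $ i)) \<le> B - c * real (\<Sum>i\<in>UNIV. x $ i)"
  shows "\<exists>\<delta>>0. \<exists>\<gamma>>0. \<exists>K::real. \<forall>x. real (\<Sum>i\<in>UNIV. x $ i) > K \<longrightarrow>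
            generator lam \<phi> (lyap_G lam \<delta>) x \<le> - \<gamma> * lyap_G lam \<delta> x"
proof -
  define A where "A = (\<Sum>i\<in>UNIV. 1 / sqrt (lam $ i))"
  define S where "S = (\<Sum>i\<in>UNIV. sqrt (lam $ i))"
  define H where "H = (\<Sum>i\<in>UNIV. 1 / sqrt (lam $ i) + 1 / lam $ i)"
  define B2 where "B2 = (\<Sum>i\<in>UNIV. (1 + B / lam $ i) / 2)"
  define B3 where "B3 = H\<^sup>2 * (\<Sum>i\<in>UNIV. lam $ i + B)"
  define \<delta> where "\<delta> = min (1 / H) (c / (4 * A * B3))"
  define \<gamma> where "\<gamma> = \<delta> * c / (4 * A)"
  define K where "K = max S (2 * (B + B2) / c)"
  have B: "B \<ge> 0" using bnd order_trans by blast
  have A: "A > 0" unfolding A_def using lam by (intro sum_pos) auto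
  have S: "S > 0" unfolding S_def using lam by (intro sum_pos) auto
  have H: "H > 0" unfolding H_def using lam by (intro sum_pos) (auto intro: add_pos_pos)
  have Hi: "1 / sqrt (lam $ i) + 1 / lam $ i \<le> H" for i
    unfolding H_def using lam by (intro member_le_sum) (auto intro!: add_nonneg_nonneg simp: less_imp_le)
  have B3: "B3 > 0" unfolding B3_def using H lam B by (intro mult_pos_pos sum_pos) (auto intro: add_pos_nonneg)
  have \<delta>: "\<delta> > 0" using H c A B3 by (simp add: \<delta>_def)
  have \<gamma>: "\<gamma> > 0" using \<delta> c A by (simp add: \<gamma>_def)
  have \<delta>H: "\<delta> * H \<le> 1"
  proof -
    have "\<delta> \<le> 1 / H" by (simp add: \<delta>_def)
    then show ?thesis using H by (simp add: field_simps)
  qed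
  have \<delta>B3: "\<delta> * B3 \<le> c / (4 * A)"
  proof -
    have "\<delta> \<le> c / (4 * A * B3)" by (simp add: \<delta>_def)
    then show ?thesis using A B3 by (simp add: field_simps)
  qed
  have "generator lam \<phi> (lyap_G lam \<delta>) x \<le> - \<gamma> * lyap_G lam \<delta> x"
    if x: "real (\<Sum>i\<in>UNIV. x $ i) > K" for x
  proof -
    define n where "n = real (\<Sum>i\<in>UNIV. x $ i)"
    define a where "a = lyap_F lam x"
    let ?G = "lyap_G lam \<delta>"
    have nS: "n > S" and nB: "n > 2 * (B + B2) / c" using x by (auto simp: n_def K_def)
    have "n \<le> S * a" using lyap_F_ge_sum[OF lam] by (simp add: n_def S_def a_def)
    then have "S * 1 \<le> S * a" using nS by linarith
    then have a1: "a \<ge> 1" using S by simp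
    have aA: "a \<le> A * n" using lyap_F_le_sum[OF lam] by (simp add: n_def A_def a_def)
    have up: "?G (x + axis i 1) - ?G x \<le> ?G x * (\<delta> * ((2 * real (x $ i) + 1) / (2 * lam $ i * a)) + \<delta>\<^sup>2 * H\<^sup>2)" for i
      using lyap_G_change[OF lam _ \<delta> \<delta>H Hi, of x 1 i "x + axis i 1"] a1
      by (simp add: a_def axis_def)
    have down: "\<phi> x i * (?G (x - axis i 1) - ?G x)
        \<le> \<phi> x i * (?G x * (\<delta> * ((1 - 2 * real (x $ i)) / (2 * lam $ i * a)) + \<delta>\<^sup>2 * H\<^sup>2))" for i
    proof (cases "x $ i = 0")
      case False
      then have "?G (x - axis i 1) - ?G x \<le> ?G x * (\<delta> * ((1 - 2 * real (x $ i)) / (2 * lam $ i * a)) + \<delta>\<^sup>2 * H\<^sup>2)"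
        using lyap_G_change[OF lam _ \<delta> \<delta>H Hi, of x "-1" i "x - axis i 1"] a1
        by (simp add: a_def axis_def of_nat_diff)
      then show ?thesis using bnd by (intro mult_left_mono) auto
    qed (simp add: zero)
    have "generator lam \<phi> ?G x \<le> (\<Sum>i\<in>UNIV.
        lam $ i * (?G x * (\<delta> * ((2 * real (x $ i) + 1) / (2 * lam $ i * a)) + \<delta>\<^sup>2 * H\<^sup>2)) +
        \<phi> x i * (?G x * (\<delta> * ((1 - 2 * real (x $ i)) / (2 * lam $ i * a)) + \<delta>\<^sup>2 * H\<^sup>2)))"
      unfolding generator_def
      by (intro sum_mono add_mono mult_left_mono up down) (simp add: lam less_imp_le)
    also have "\<dots> = (\<Sum>i\<in>UNIV. ?G x * (\<delta> / a * (real (x $ i) * (1 - \<phi> x i / lam $ i) + (1 + \<phi> x i / lam $ i) / 2)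
        + \<delta>\<^sup>2 * H\<^sup>2 * (lam $ i + \<phi> x i)))"
    proof (rule sum.cong)
      fix i
      have "lam $ i \<noteq> 0" "a \<noteq> 0" using lam[of i] a1 by auto
      then show "lam $ i * (?G x * (\<delta> * ((2 * real (x $ i) + 1) / (2 * lam $ i * a)) + \<delta>\<^sup>2 * H\<^sup>2)) +
        \<phi> x i * (?G x * (\<delta> * ((1 - 2 * real (x $ i)) / (2 * lam $ i * a)) + \<delta>\<^sup>2 * H\<^sup>2))
        = ?G x * (\<delta> / a * (real (x $ i) * (1 - \<phi> x i / lam $ i) + (1 + \<phi> x i / lam $ i) / 2)
        + \<delta>\<^sup>2 * H\<^sup>2 * (lam $ i + \<phi> x i))"
        by (simp add: field_simps)
    qed simp
    also have "\<dots> = ?G x * (\<delta> / a * ((\<Sum>i\<in>UNIV. real (x $ i) * (1 - \<phi> x i / lam $ i)) + (\<Sum>i\<in>UNIV. (1 + \<phi> x i / lam $ i) / 2))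
        + \<delta>\<^sup>2 * H\<^sup>2 * (\<Sum>i\<in>UNIV. lam $ i + \<phi> x i))"
      by (simp only: sum_distrib_left[symmetric] sum.distrib)
    also have "\<dots> \<le> ?G x * (\<delta> / a * ((B - c * n) + B2) + \<delta>\<^sup>2 * H\<^sup>2 * (\<Sum>i\<in>UNIV. lam $ i + B))"
    proof (intro mult_left_mono add_mono)
      show "(\<Sum>i\<in>UNIV. real (x $ i) * (1 - \<phi> x i / lam $ i)) \<le> B - c * n" using drift by (simp add: n_def)
      show "(\<Sum>i\<in>UNIV. (1 + \<phi> x i / lam $ i) / 2) \<le> B2"
        unfolding B2_def using bnd lam
        by (intro sum_mono divide_right_mono add_mono) (auto simp: less_imp_le)
      show "(\<Sum>i\<in>UNIV. lam $ i + \<phi> x i) \<le> (\<Sum>i\<in>UNIV. lam $ i + B)"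
        using bnd by (intro sum_mono) auto
    qed (use \<delta> a1 in \<open>auto simp: lyap_G_def\<close>)
    also have "\<dots> \<le> ?G x * (- \<gamma>)"
    proof (rule mult_left_mono)
      have "B + B2 < c * n / 2" using nB c by (simp add: field_simps)
      then have "\<delta> / a * ((B - c * n) + B2) \<le> \<delta> / a * (- (c * n / 2))"
        using \<delta> a1 by (intro mult_left_mono) auto
      also have "\<dots> = - (\<delta> * c / 2) * (n / a)" by simp
      also have "\<dots> \<le> - (\<delta> * c / 2) * (1 / A)"
        using aA A a1 \<delta> c by (intro mult_left_mono_neg) (auto simp: field_simps)
      also have "\<dots> = - 2 * \<gamma>" by (simp add: \<gamma>_def)
      finally have 1: "\<delta> / a * ((B - c * n) + B2) \<le> - 2 * \<gamma>" .
      have "\<delta>\<^sup>2 * H\<^sup>2 * (\<Sum>i\<in>UNIV. lam $ i + B) = \<delta> * (\<delta> * B3)" by (simp add: B3_def power2_eq_square mult_ac)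
      also have "\<dots> \<le> \<delta> * (c / (4 * A))" using \<delta>B3 \<delta> by (intro mult_left_mono) auto
      also have "\<dots> = \<gamma>" by (simp add: \<gamma>_def)
      finally show "\<delta> / a * ((B - c * n) + B2) + \<delta>\<^sup>2 * H\<^sup>2 * (\<Sum>i\<in>UNIV. lam $ i + B) \<le> - \<gamma>"
        using 1 by linarith
    qed (simp add: lyap_G_def)
    finally show ?thesis by (simp add: mult.commute)
  qed
  with \<delta> \<gamma> show ?thesis by blast
qed

lemma finite_sublevel_lyap_G:
  assumes lam: "\<And>i. lam $ i > 0" and \<delta>: "\<delta> > 0"
  shows "finite {x. lyap_G lam \<delta> x \<le> R}"
proof -
  define S where "S = (\<Sum>i\<in>UNIV. sqrt (lam $ i))"
  have S: "S > 0" unfolding S_def using lam by (intro sum_pos) auto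
  define m where "m = nat \<lceil>S * (R / \<delta>)\<rceil>"
  have "x $ i \<le> m" if "lyap_G lam \<delta> x \<le> R" for x i
  proof -
    have "1 + \<delta> * lyap_F lam x \<le> R" using that exp_ge_add_one_self[of "\<delta> * lyap_F lam x"] unfolding lyap_G_def by linarith
    then have "lyap_F lam x \<le> R / \<delta>" using \<delta> by (simp add: field_simps)
    then have "S * lyap_F lam x \<le> S * (R / \<delta>)" using S by (intro mult_left_mono) auto
    then have "real (\<Sum>i\<in>UNIV. x $ i) \<le> S * (R / \<delta>)" using lyap_F_ge_sum[OF lam, of x] unfolding S_def by linarith
    moreover have "x $ i \<le> (\<Sum>i\<in>UNIV. x $ i)" by (rule member_le_sum) auto
    ultimately show ?thesis unfolding m_def by linarith
  qed
  then have "{x. lyap_G lam \<delta> x \<le> R} \<subseteq> vec_lambda ` (PiE UNIV (\<lambda>_. {..m}))"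
    by (auto simp: image_iff intro!: bexI[where x="vec_nth _"])
  then show ?thesis using finite_PiE[of UNIV "\<lambda>_. {..m}"] finite_subset finite_imageI by (metis finite finite_atMost)
qed

section \<open>Expectations and probability mass functions\<close>

lemma integrable_pmf_bounded:
  fixes f :: "'a \<Rightarrow> real"
  assumes "\<And>y. \<bar>f y\<bar> \<le> B"
  shows "integrable (measure_pmf p) f"
  by (rule measure_pmf.integrable_const_bound[where B=B]) (use assms in auto)

lemma expectation_bind_pmf:
  fixes f :: "'b \<Rightarrow> real"
  assumes f: "\<And>y. 0 \<le> f y" "\<And>y. f y \<le> B"
  shows "measure_pmf.expectation (bind_pmf p K) f = measure_pmf.expectation p (\<lambda>x. measure_pmf.expectation (K x) f)"
proof -
  have int: "integrable (measure_pmf p') f" for p'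
    using f by (intro integrable_pmf_bounded[where B=B]) auto
  have e: "0 \<le> measure_pmf.expectation (K x) f" "measure_pmf.expectation (K x) f \<le> B" for x
    using f by (auto intro!: integral_nonneg measure_pmf.integral_le_const int)
  have int': "integrable (measure_pmf p) (\<lambda>x. measure_pmf.expectation (K x) f)"
    using e by (intro integrable_pmf_bounded[where B=B]) auto
  have "ennreal (measure_pmf.expectation (bind_pmf p K) f) = (\<integral>\<^sup>+x. \<integral>\<^sup>+y. ennreal (f y) \<partial>K x \<partial>p)"
    using f by (simp add: nn_integral_eq_integral[OF int, symmetric])
  also have "\<dots> = ennreal (measure_pmf.expectation p (\<lambda>x. measure_pmf.expectation (K x) f))"
    using f e by (simp add: nn_integral_eq_integral[OF int] nn_integral_eq_integral[OF int'])
  finally show ?thesis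
    using f e by (subst (asm) ennreal_inj) (auto intro!: integral_nonneg)
qed

text \<open>
  The error is the mass outside \<open>A\<close>, written without the complement so that limits can be
  taken in a finite sum of point masses.
\<close>

lemma expectation_finite_approx:
  fixes g :: "'a \<Rightarrow> real"
  assumes A: "finite A" and g: "\<And>y. \<bar>g y\<bar> \<le> B"
  shows "\<bar>measure_pmf.expectation p g - (\<Sum>y\<in>A. pmf p y * g y)\<bar> \<le> B * (1 - (\<Sum>y\<in>A. pmf p y))"
proof -
  have intA: "integrable (measure_pmf p) (\<lambda>y. g y * indicator S y)" for S
  proof (rule integrable_pmf_bounded[where B=B])
    show "\<bar>g y * indicator S y\<bar> \<le> B" for y using g[of y] by (auto simp: indicator_def)
  qed
  have "measure_pmf.expectation p g = measure_pmf.expectation p (\<lambda>y. g y * indicator A y + g y * indicator (- A) y)"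
    by (rule Bochner_Integration.integral_cong) (auto simp: indicator_def)
  also have "\<dots> = measure_pmf.expectation p (\<lambda>y. g y * indicator A y) + measure_pmf.expectation p (\<lambda>y. g y * indicator (- A) y)"
    by (rule Bochner_Integration.integral_add[OF intA intA])
  also have "measure_pmf.expectation p (\<lambda>y. g y * indicator A y) = (\<Sum>y\<in>A. pmf p y * g y)"
    using A by (subst integral_measure_pmf_real[of A]) (auto simp: mult_ac indicator_def intro!: sum.cong)
  finally have eq: "measure_pmf.expectation p g - (\<Sum>y\<in>A. pmf p y * g y) = measure_pmf.expectation p (\<lambda>y. g y * indicator (- A) y)"
    by simp
  have "\<bar>measure_pmf.expectation p (\<lambda>y. g y * indicator (- A) y)\<bar>
      \<le> measure_pmf.expectation p (\<lambda>y. \<bar>g y * indicator (- A) y\<bar>)"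
    by (rule integral_abs_bound)
  also have "\<dots> \<le> measure_pmf.expectation p (\<lambda>y. B * indicator (- A) y)"
  proof (rule integral_mono)
    show "integrable (measure_pmf p) (\<lambda>y. B * indicator (- A) y)"
      by (rule integrable_pmf_bounded[where B="\<bar>B\<bar>"]) (auto simp: indicator_def)
    show "\<bar>g y * indicator (- A) y\<bar> \<le> B * indicator (- A) y" for y
      using g[of y] by (auto simp: indicator_def)
  qed (rule integrable_abs[OF intA])
  also have "\<dots> = B * measure_pmf.prob p (- A)" by simp
  also have "\<dots> = B * (1 - (\<Sum>y\<in>A. pmf p y))"
    using A measure_pmf.prob_compl[of A p] by (simp add: measure_measure_pmf_finite Compl_eq_Diff_UNIV)
  finally show ?thesis using eq by simp
qed

lemma expectation_truncation_limit:
  fixes V :: "'a \<Rightarrow> real"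
  assumes V: "\<And>y. 0 \<le> V y" and le: "\<And>n::nat. measure_pmf.expectation p (\<lambda>y. min (V y) (real n)) \<le> c"
  shows "integrable (measure_pmf p) V" "measure_pmf.expectation p V \<le> c"
proof -
  have int: "integrable (measure_pmf p) (\<lambda>y. min (V y) (real n))" for n
  proof (rule integrable_pmf_bounded[where B="real n"])
    show "\<bar>min (V y) (real n)\<bar> \<le> real n" for y using V[of y] by (simp add: min_def)
  qed
  have c: "c \<ge> 0" using le[of 0] V by (simp add: min_absorb2)
  have "(\<lambda>n. \<integral>\<^sup>+y. ennreal (min (V y) (real n)) \<partial>p) \<longlonglongrightarrow> (\<integral>\<^sup>+y. ennreal (V y) \<partial>p)"
  proof (rule nn_integral_LIMSEQ)
    show "incseq (\<lambda>n y. ennreal (min (V y) (real n)))"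
      by (auto simp: incseq_def le_fun_def intro!: ennreal_leI min.mono)
    fix y
    have "eventually (\<lambda>n. ennreal (min (V y) (real n)) = ennreal (V y)) sequentially"
    proof -
      obtain k :: nat where "V y \<le> real k" using real_arch_simple by blast
      then show ?thesis unfolding eventually_sequentially
        by (intro exI[of _ k]) (auto simp: min_absorb1)
    qed
    then show "(\<lambda>n. ennreal (min (V y) (real n))) \<longlonglongrightarrow> ennreal (V y)"
      by (rule tendsto_eventually)
  qed auto
  moreover have "(\<integral>\<^sup>+y. ennreal (min (V y) (real n)) \<partial>p) \<le> ennreal c" for n
    using le[of n] V by (subst nn_integral_eq_integral[OF int]) (auto intro!: ennreal_leI)
  ultimately have *: "(\<integral>\<^sup>+y. ennreal (V y) \<partial>p) \<le> ennreal c"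
    by (intro LIMSEQ_le_const2) auto
  then show i: "integrable (measure_pmf p) V"
    using V by (intro integrableI_nonneg) (auto simp: order_le_less_trans[OF * ennreal_less_top])
  show "measure_pmf.expectation p V \<le> c"
    using * V c by (subst (asm) nn_integral_eq_integral[OF i]) auto
qed

lemma DERIV_left_quotient:
  fixes f :: "real \<Rightarrow> real"
  assumes "DERIV f t :> D"
  shows "((\<lambda>s. (f t - f (t - s)) / s) \<longlongrightarrow> D) (at_right 0)"
proof -
  have "((\<lambda>h. (f (t + h) - f t) / h) \<longlongrightarrow> D) (at 0)"
    using assms by (simp add: DERIV_def)
  moreover have "filterlim (\<lambda>s::real. - s) (at 0) (at_right 0)"
    by (auto simp: filterlim_at eventually_at_filter intro!: tendsto_eq_intros)
  ultimately have "((\<lambda>s. (f (t + - s) - f t) / (- s)) \<longlongrightarrow> D) (at_right 0)"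
    by (rule filterlim_compose)
  then show ?thesis by (simp add: minus_divide_left)
qed

section \<open>Chains with finitely many jumps out of each state\<close>

locale finite_rate_chain =
  fixes P :: "real \<Rightarrow> 's \<Rightarrow> 's pmf" and q :: "'s \<Rightarrow> 's \<Rightarrow> real" and N :: "'s \<Rightarrow> 's set"
  assumes transition: "transition_function P" and rates: "has_rates P q"
    and finite_N: "finite (N x)" and not_self_N: "x \<notin> N x"
    and outside_N: "y \<noteq> x \<Longrightarrow> y \<notin> N x \<Longrightarrow> q x y = 0"
begin

definition evolve :: "('s \<Rightarrow> real) \<Rightarrow> real \<Rightarrow> 's \<Rightarrow> real" where
  "evolve f t x = measure_pmf.expectation (P t x) f"

definition gen :: "('s \<Rightarrow> real) \<Rightarrow> 's \<Rightarrow> real" where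
  "gen f x = (\<Sum>y\<in>N x. q x y * (f y - f x))"

lemma P_0: "P 0 x = return_pmf x"
  using transition by (simp add: transition_function_def)

lemma P_add: "0 \<le> s \<Longrightarrow> 0 \<le> t \<Longrightarrow> P (s + t) x = bind_pmf (P s x) (P t)"
  using transition by (simp add: transition_function_def)

lemma rate_tendsto: "x \<noteq> y \<Longrightarrow> ((\<lambda>h. pmf (P h x) y / h) \<longlongrightarrow> q x y) (at_right 0)"
  using rates by (simp add: has_rates_def)

text \<open>
  Conservativity: the total exit rate is carried by the finitely many neighbours, so the
  probability of being at any other state after time \<open>h\<close> is \<open>o(h)\<close>.
\<close>

lemma exit_rate_tendsto: "((\<lambda>h. (1 - pmf (P h x) x) / h) \<longlongrightarrow> (\<Sum>y\<in>N x. q x y)) (at_right 0)"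
proof -
  have "(\<Sum>\<^sub>\<infinity>y\<in>-{x}. q x y) = (\<Sum>\<^sub>\<infinity>y\<in>N x. q x y)"
    by (rule infsum_cong_neutral) (use outside_N not_self_N in auto)
  then have "(\<Sum>\<^sub>\<infinity>y\<in>-{x}. q x y) = (\<Sum>y\<in>N x. q x y)" using finite_N by simp
  moreover have "((\<lambda>h. (1 - pmf (P h x) x) / h) \<longlongrightarrow> (\<Sum>\<^sub>\<infinity>y\<in>-{x}. q x y)) (at_right 0)"
    using rates unfolding has_rates_def by blast
  ultimately show ?thesis by metis
qed

lemma rate_nonneg: "x \<noteq> y \<Longrightarrow> q x y \<ge> 0"
  by (rule tendsto_lowerbound[OF rate_tendsto])
    (auto simp: eventually_at_right_field intro!: exI[of _ 1])

lemma stay_prob_tendsto: "((\<lambda>h. pmf (P h x) x) \<longlongrightarrow> 1) (at_right 0)"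
proof -
  have "((\<lambda>h. 1 - h * ((1 - pmf (P h x) x) / h)) \<longlongrightarrow> 1 - 0 * (\<Sum>y\<in>N x. q x y)) (at_right 0)"
    by (intro tendsto_intros exit_rate_tendsto)
  moreover have "eventually (\<lambda>h. 1 - h * ((1 - pmf (P h x) x) / h) = pmf (P h x) x) (at_right 0)"
    by (auto simp: eventually_at_right_field intro!: exI[of _ 1])
  ultimately show ?thesis using Lim_transform_eventually by fastforce
qed

lemma evolve_bounds:
  assumes "\<And>y. 0 \<le> f y" "\<And>y. f y \<le> B"
  shows "0 \<le> evolve f t x" "evolve f t x \<le> B"
  unfolding evolve_def using assms
  by (auto intro!: integral_nonneg measure_pmf.integral_le_const integrable_pmf_bounded[where B=B])

lemma evolve_0: "evolve f 0 x = f x"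
  by (simp add: evolve_def P_0)

lemma evolve_add:
  assumes "\<And>y. 0 \<le> f y" "\<And>y. f y \<le> B" "0 \<le> s" "0 \<le> t"
  shows "evolve f (s + t) x = measure_pmf.expectation (P s x) (evolve f t)"
  unfolding evolve_def P_add[OF assms(3,4)]
  by (rule expectation_bind_pmf[OF assms(1,2)])

text \<open>
  Splitting off the short time \<open>s\<close> at the start, rather than at the end, leads to the backward
  equation: the increments are then controlled by the jumps out of the single state \<open>x\<close>.
\<close>

lemma evolve_increment:
  assumes f: "\<And>y. 0 \<le> f y" "\<And>y. f y \<le> B" and st: "0 \<le> s" "0 \<le> t"
  shows "evolve f (s + t) x - evolve f t x
    = measure_pmf.expectation (P s x) (\<lambda>y. evolve f t y - evolve f t x)"
proof -
  have "integrable (measure_pmf (P s x)) (evolve f t)"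
    using evolve_bounds[of f B] f by (intro integrable_pmf_bounded[where B=B]) auto
  then show ?thesis using evolve_add[OF f st] by simp
qed

lemma evolve_increment_bound:
  assumes f: "\<And>y. 0 \<le> f y" "\<And>y. f y \<le> B" and st: "0 \<le> s" "0 \<le> t"
  shows "\<bar>evolve f (s + t) x - evolve f t x\<bar> \<le> B * (1 - pmf (P s x) x)"
proof -
  have b: "0 \<le> evolve f t y" "evolve f t y \<le> B" for y using evolve_bounds[of f B] f by auto
  have "\<bar>evolve f t y - evolve f t x\<bar> \<le> B" for y using b[of x] b[of y] by linarith
  from expectation_finite_approx[where A="{x}" and p="P s x" and g="\<lambda>y. evolve f t y - evolve f t x", OF _ this] show ?thesis
    by (simp add: evolve_increment[OF f st])
qed

lemma continuous_on_evolve: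
  assumes f: "\<And>y. 0 \<le> f y" "\<And>y. f y \<le> B"
  shows "continuous_on {0..} (\<lambda>t. evolve f t x)"
proof -
  have B: "B \<ge> 0" using f order_trans by blast
  have "\<exists>d>0. \<forall>s\<in>{0..}. \<forall>t\<in>{0..}. dist s t < d \<longrightarrow> dist (evolve f s x) (evolve f t x) < e" if "e > 0" for e
  proof -
    have "((\<lambda>h. B * (1 - pmf (P h x) x)) \<longlongrightarrow> B * (1 - 1)) (at_right 0)"
      by (intro tendsto_intros stay_prob_tendsto)
    then have "eventually (\<lambda>h. B * (1 - pmf (P h x) x) < e) (at_right 0)"
      using \<open>e > 0\<close> by (intro order_tendstoD(2)) auto
    then obtain d where d: "d > 0" "\<And>h. 0 < h \<Longrightarrow> h < d \<Longrightarrow> B * (1 - pmf (P h x) x) < e"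
      by (auto simp: eventually_at_right_field)
    have *: "dist (evolve f s x) (evolve f t x) < e" if "0 \<le> t" "t < s" "s - t < d" for s t
      using evolve_increment_bound[of f B "s - t" t x, OF f] that d(2)[of "s - t"] by (simp add: dist_real_def)
    have "dist (evolve f s x) (evolve f t x) < e" if "0 \<le> s" "0 \<le> t" "dist s t < d" for s t
      using *[of s t] *[of t s] that \<open>e > 0\<close>
      by (cases s t rule: linorder_cases) (auto simp: dist_real_def dist_commute)
    with d(1) show ?thesis by auto
  qed
  then show ?thesis
    by (intro uniformly_continuous_imp_continuous) (auto simp: uniformly_continuous_on_def dist_commute)
qed

text \<open>
  The backward equation, as a left derivative since the maximum principle looks backwards in
  time from a minimum. The time-shifted values \<open>evolve f (t - h)\<close> inside the sum converge by
  continuity in time, and the states outside \<open>insert x (N x)\<close> contribute \<open>o(h)\<close>.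
\<close>

lemma evolve_left_derivative:
  assumes f: "\<And>y. 0 \<le> f y" "\<And>y. f y \<le> B" and t: "t > 0"
  shows "((\<lambda>h. (evolve f t x - evolve f (t - h) x) / h) \<longlongrightarrow> gen (evolve f t) x) (at_right 0)"
proof -
  let ?u = "\<lambda>h y. evolve f (t - h) y"
  let ?main = "\<lambda>h. \<Sum>y\<in>N x. pmf (P h x) y / h * (?u h y - ?u h x)"
  let ?rest = "\<lambda>h. B * ((1 - pmf (P h x) x) / h - (\<Sum>y\<in>N x. pmf (P h x) y / h))"
  have near: "eventually (\<lambda>h. 0 < h \<and> h < t) (at_right 0)"
    using t by (auto simp: eventually_at_right_field)
  have u: "((\<lambda>h. ?u h y) \<longlongrightarrow> evolve f t y) (at_right 0)" for y
  proof (rule continuous_on_tendsto_compose[OF continuous_on_evolve[OF f]])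
    show "((\<lambda>h. t - h) \<longlongrightarrow> t) (at_right 0)" by (auto intro!: tendsto_eq_intros)
    show "eventually (\<lambda>h. t - h \<in> {0..}) (at_right 0)" using near by eventually_elim auto
  qed (use t in auto)
  have main: "(?main \<longlongrightarrow> gen (evolve f t) x) (at_right 0)"
    unfolding gen_def using not_self_N by (intro tendsto_intros rate_tendsto u) auto
  have "(?rest \<longlongrightarrow> B * ((\<Sum>y\<in>N x. q x y) - (\<Sum>y\<in>N x. q x y))) (at_right 0)"
    using not_self_N by (intro tendsto_intros exit_rate_tendsto rate_tendsto) auto
  then have rest: "(?rest \<longlongrightarrow> 0) (at_right 0)" by simp
  have "((\<lambda>h. (evolve f t x - ?u h x) / h - ?main h) \<longlongrightarrow> 0) (at_right 0)"
  proof (rule Lim_null_comparison[OF _ rest])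
    show "eventually (\<lambda>h. norm ((evolve f t x - ?u h x) / h - ?main h) \<le> ?rest h) (at_right 0)"
      using near
    proof eventually_elim
      case (elim h)
      have b: "0 \<le> ?u h y" "?u h y \<le> B" for y using evolve_bounds[of f B] f by auto
      have diff: "\<bar>?u h y - ?u h x\<bar> \<le> B" for y using b[of x] b[of y] by linarith
      have inc: "evolve f t x - ?u h x = measure_pmf.expectation (P h x) (\<lambda>y. ?u h y - ?u h x)"
        using evolve_increment[of f B h "t - h" x, OF f] elim by simp
      have "\<bar>(evolve f t x - ?u h x) - (\<Sum>y\<in>N x. pmf (P h x) y * (?u h y - ?u h x))\<bar>
          \<le> B * (1 - (pmf (P h x) x + (\<Sum>y\<in>N x. pmf (P h x) y)))"
        using expectation_finite_approx[where B=B and g="\<lambda>y. ?u h y - ?u h x" and A="insert x (N x)" and p="P h x", OF _ diff] finite_N not_self_N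
        by (simp add: inc)
      then have "\<bar>(evolve f t x - ?u h x) - (\<Sum>y\<in>N x. pmf (P h x) y * (?u h y - ?u h x))\<bar> / h
          \<le> B * (1 - (pmf (P h x) x + (\<Sum>y\<in>N x. pmf (P h x) y))) / h"
        using elim by (intro divide_right_mono) auto
      also have "\<bar>(evolve f t x - ?u h x) - (\<Sum>y\<in>N x. pmf (P h x) y * (?u h y - ?u h x))\<bar> / h
          = \<bar>((evolve f t x - ?u h x) - (\<Sum>y\<in>N x. pmf (P h x) y * (?u h y - ?u h x))) / h\<bar>"
        using elim by simp
      also have "((evolve f t x - ?u h x) - (\<Sum>y\<in>N x. pmf (P h x) y * (?u h y - ?u h x))) / h
          = (evolve f t x - ?u h x) / h - ?main h"
        by (simp add: diff_divide_distrib sum_divide_distrib)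
      also have "B * (1 - (pmf (P h x) x + (\<Sum>y\<in>N x. pmf (P h x) y))) / h = ?rest h"
      proof -
        have "(\<Sum>y\<in>N x. pmf (P h x) y / h) = (\<Sum>y\<in>N x. pmf (P h x) y) / h"
          by (simp add: sum_divide_distrib)
        then show ?thesis by (simp add: diff_divide_distrib add_divide_distrib algebra_simps)
      qed
      finally show ?case by simp
    qed
  qed
  from tendsto_add[OF this main] show ?thesis by simp
qed

text \<open>
  The right-hand side \<open>w\<close> satisfies \<open>w' \<ge> Q w\<close> and starts above \<open>f\<close>. If \<open>w\<close> fell below
  \<open>evolve f\<close>, then \<open>h = w - evolve f + e t\<close> would take a negative value for a small \<open>e > 0\<close>. As
  \<open>evolve f\<close> is bounded and \<open>w\<close> is large outside a finite set of states, \<open>h\<close> attains a negative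
  minimum over time and space, at a positive time. There the left derivative of \<open>h\<close> is at most
  0 and \<open>Q h\<close> is at least 0, which contradicts \<open>h' \<ge> Q h + e\<close>.
\<close>

lemma evolve_le_supersolution:
  assumes f: "\<And>y. 0 \<le> f y" "\<And>y. f y \<le> B" "\<And>y. f y \<le> V y"
    and V: "\<And>R. finite {y. V y \<le> R}"
    and \<gamma>: "\<gamma> > 0" and b: "b \<ge> 0" and drift: "\<And>x. gen V x \<le> b - \<gamma> * V x" and T: "T \<ge> 0"
  shows "evolve f T x \<le> exp (- \<gamma> * T) * V x + b / \<gamma> * (1 - exp (- \<gamma> * T))"
proof (rule ccontr)
  define w where "w t y = exp (- \<gamma> * t) * V y + b / \<gamma> * (1 - exp (- \<gamma> * t))" for t y
  assume "\<not> ?thesis"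
  then have neg: "w T x < evolve f T x" by (simp add: w_def)
  \<comment> \<open>Small enough that adding \<open>e * T\<close> does not repair the violation at \<open>(T, x)\<close>.\<close>
  define e where "e = (evolve f T x - w T x) / (2 * (T + 1))"
  have e: "e > 0" using neg T by (simp add: e_def)
  define h where "h t y = w t y - evolve f t y + e * t" for t y
  have hx: "h T x < 0"
  proof -
    have "e * T < e * (2 * (T + 1))" using e T by simp
    also have "\<dots> = evolve f T x - w T x" using T by (simp add: e_def)
    finally show ?thesis by (simp add: h_def)
  qed
  have V0: "V y \<ge> 0" for y using f(1,3) order_trans by blast
  have ub: "evolve f t y \<le> B" for t y using evolve_bounds[of f B] f by auto
  define A where "A = {y. V y \<le> B * exp (\<gamma> * T)}"
  have A: "finite A" using V by (simp add: A_def)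
  have outside: "h t y \<ge> 0" if y: "y \<notin> A" and t: "t \<in> {0..T}" for t y
  proof -
    have "B * exp (\<gamma> * T) < V y" using y by (simp add: A_def)
    then have "B \<le> exp (- \<gamma> * T) * V y" by (simp add: exp_minus field_simps)
    also have "\<dots> \<le> exp (- \<gamma> * t) * V y"
      using t \<gamma> V0 by (intro mult_right_mono) auto
    finally have "B \<le> exp (- \<gamma> * t) * V y" .
    moreover have "b / \<gamma> * (1 - exp (- \<gamma> * t)) \<ge> 0" "e * t \<ge> 0" using b \<gamma> t e by auto
    ultimately show ?thesis using ub[of t y] by (simp add: h_def w_def)
  qed
  have cont: "continuous_on {0..T} (\<lambda>t. h t y)" for y
    unfolding h_def w_def
    by (intro continuous_intros continuous_on_subset[OF continuous_on_evolve[of f B y, OF f(1,2)]]) auto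
  have "\<exists>s\<in>{0..T}. \<forall>t\<in>{0..T}. h s y \<le> h t y" for y
    using continuous_attains_inf[OF _ _ cont[of y]] T by auto
  then obtain \<tau> where \<tau>: "\<tau> y \<in> {0..T}" "\<And>t. t \<in> {0..T} \<Longrightarrow> h (\<tau> y) y \<le> h t y" for y
    by metis
  have xA: "x \<in> A" using outside[of x T] hx T by auto
  define m where "m = Min ((\<lambda>y. h (\<tau> y) y) ` A)"
  have "m \<in> (\<lambda>y. h (\<tau> y) y) ` A" unfolding m_def using A xA by (intro Min_in) auto
  then obtain z where z: "z \<in> A" "h (\<tau> z) z = m" by auto
  have mA: "m \<le> h (\<tau> y) y" if "y \<in> A" for y unfolding m_def using A that by (intro Min_le) auto
  have m0: "m < 0" using mA[OF xA] \<tau>(2)[of T x] hx T by auto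
  define s where "s = \<tau> z"
  have min: "h s z \<le> h t y" if "t \<in> {0..T}" for t y
    using mA[of y] \<tau>(2)[OF that, of y] outside[of y t] that z(2) m0 unfolding s_def by (cases "y \<in> A") auto
  have s: "0 < s" "s \<le> T"
  proof -
    have "h 0 z \<ge> 0" using f(3)[of z] by (simp add: h_def w_def evolve_0)
    then have "s \<noteq> 0" using z(2) m0 by (auto simp: s_def)
    then show "0 < s" "s \<le> T" using \<tau>(1)[of z] by (auto simp: s_def)
  qed
  let ?D = "exp (- \<gamma> * s) * (b - \<gamma> * V z)"
  have "DERIV (\<lambda>t. w t z + e * t) s :> ?D + e"
    unfolding w_def using \<gamma> by (auto intro!: derivative_eq_intros simp: field_simps)
  from tendsto_diff[OF DERIV_left_quotient[OF this] evolve_left_derivative[of f B s z, OF f(1,2) s(1)]]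
  have lim: "((\<lambda>r. (h s z - h (s - r) z) / r) \<longlongrightarrow> ?D + e - gen (evolve f s) z) (at_right 0)"
    by (rule Lim_transform_eventually) (auto simp: h_def diff_divide_distrib add_divide_distrib)
  have "?D + e - gen (evolve f s) z \<le> 0"
  proof (rule tendsto_upperbound[OF lim])
    have "eventually (\<lambda>r. 0 < r \<and> r < s) (at_right 0)"
      using s by (auto simp: eventually_at_right_field)
    then show "eventually (\<lambda>r. (h s z - h (s - r) z) / r \<le> 0) (at_right 0)"
    proof eventually_elim
      case (elim r)
      then show ?case using min[of "s - r" z] s by (intro divide_nonpos_pos) auto
    qed
  qed simp
  moreover have "exp (- \<gamma> * s) * gen V z \<le> ?D" using drift by (intro mult_left_mono) auto
  moreover have "exp (- \<gamma> * s) * gen V z - gen (evolve f s) z = (\<Sum>y\<in>N z. q z y * (h s y - h s z))"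
    unfolding gen_def h_def w_def sum_distrib_left sum_subtractf[symmetric]
    by (intro sum.cong) (auto simp: algebra_simps)
  moreover have "\<dots> \<ge> 0"
    using min s not_self_N rate_nonneg by (intro sum_nonneg mult_nonneg_nonneg) (auto, metis)
  ultimately show False using e by linarith
qed

text \<open>
  The maximum principle applies to bounded functions only, so \<open>V\<close> is truncated at \<open>n\<close> and
  recovered by monotone convergence.
\<close>

lemma expectation_lyapunov:
  assumes V0: "\<And>y. 0 \<le> V y" and V: "\<And>R. finite {y. V y \<le> R}"
    and \<gamma>: "\<gamma> > 0" and b: "b \<ge> 0" and drift: "\<And>x. gen V x \<le> b - \<gamma> * V x" and t: "t \<ge> 0"
  shows "integrable (measure_pmf (P t x)) V"
    and "measure_pmf.expectation (P t x) V \<le> exp (- \<gamma> * t) * V x + b / \<gamma>"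
proof -
  have "measure_pmf.expectation (P t x) (\<lambda>y. min (V y) (real n)) \<le> exp (- \<gamma> * t) * V x + b / \<gamma>" for n
  proof -
    have "evolve (\<lambda>y. min (V y) (real n)) t x \<le> exp (- \<gamma> * t) * V x + b / \<gamma> * (1 - exp (- \<gamma> * t))"
      by (rule evolve_le_supersolution[where B="real n"]) (use assms in auto)
    also have "\<dots> \<le> exp (- \<gamma> * t) * V x + b / \<gamma>"
      using \<gamma> b by (simp add: field_simps)
    finally show ?thesis by (simp add: evolve_def)
  qed
  from expectation_truncation_limit[of V "P t x", OF V0 this]
  show "integrable (measure_pmf (P t x)) V"
    and "measure_pmf.expectation (P t x) V \<le> exp (- \<gamma> * t) * V x + b / \<gamma>" by auto
qed

text \<open>
  A chain stays put with positive probability during a short time, and a long time consists of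
  finitely many short ones.
\<close>

lemma stay_positive:
  assumes "t \<ge> 0" shows "x \<in> set_pmf (P t x)"
proof (cases "t = 0")
  case False
  have "eventually (\<lambda>h. pmf (P h x) x > 0) (at_right 0)"
    using stay_prob_tendsto by (rule order_tendstoD) simp
  then obtain d where d: "d > 0" "\<And>h. 0 < h \<Longrightarrow> h < d \<Longrightarrow> pmf (P h x) x > 0"
    by (auto simp: eventually_at_right_field)
  obtain n :: nat where n: "t / d < real n" using reals_Archimedean2 by blast
  moreover have "t / d > 0" using d False assms by simp
  ultimately have n0: "real n > 0" by linarith
  define h where "h = t / real n"
  have h: "0 < h" "h < d" using n n0 d False assms by (auto simp: h_def field_simps)
  have "x \<in> set_pmf (P (real k * h) x)" for k
  proof (induction k)
    case (Suc k)
    have "P (real k * h + h) x = bind_pmf (P (real k * h) x) (P h)" using h by (intro P_add) auto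
    then show ?case using Suc d(2)[OF h] by (auto simp: algebra_simps set_pmf_iff intro!: bexI[of _ x])
  qed (simp add: P_0)
  from this[of n] show ?thesis using n0 by (simp add: h_def)
qed (simp add: P_0)

text \<open>
  Follow a path of positive rates along which \<open>m\<close> decreases: each jump can be made in an
  arbitrarily short time, so the whole path fits into \<open>t\<close>, and the rest is spent at \<open>a\<close>.
\<close>

lemma reach_positive:
  assumes descent: "\<And>x. x \<noteq> a \<Longrightarrow> \<exists>y. y \<noteq> x \<and> q x y > 0 \<and> (m y :: nat) < m x" and t: "t > 0"
  shows "a \<in> set_pmf (P t x)"
  using t
proof (induction "m x" arbitrary: x t rule: less_induct)
  case less
  show ?case
  proof (cases "x = a")
    case True
    then show ?thesis using stay_positive less.prems by simp
  next
    case False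
    then obtain y where y: "y \<noteq> x" "q x y > 0" "m y < m x" using descent by blast
    have "eventually (\<lambda>h. pmf (P h x) y / h > 0) (at_right 0)"
      using y by (intro order_tendstoD(1)[OF rate_tendsto]) auto
    moreover have "eventually (\<lambda>h. 0 < h \<and> h < t) (at_right 0)"
      using less.prems by (auto simp: eventually_at_right_field)
    ultimately have "eventually (\<lambda>h. pmf (P h x) y / h > 0 \<and> 0 < h \<and> h < t) (at_right 0)"
      by eventually_elim auto
    then obtain h where h: "pmf (P h x) y / h > 0" "0 < h" "h < t"
      using eventually_happens trivial_limit_at_right_real by blast
    have "y \<in> set_pmf (P h x)" using h by (auto simp: set_pmf_iff)
    moreover have "a \<in> set_pmf (P (t - h) y)" using less.hyps[OF y(3)] h by simp
    moreover have "P (h + (t - h)) x = bind_pmf (P h x) (P (t - h))" using h by (intro P_add) auto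
    ultimately show ?thesis by auto
  qed
qed

end

section \<open>Couplings and limits of probability mass functions\<close>

lemma integrable_pair_fst_snd:
  fixes V :: "'a \<Rightarrow> real"
  assumes "integrable (measure_pmf p1) V" "integrable (measure_pmf p2) V"
  shows "integrable (measure_pmf (pair_pmf p1 p2)) (\<lambda>z. V (fst z))"
    and "integrable (measure_pmf (pair_pmf p1 p2)) (\<lambda>z. V (snd z))"
  using assms integrable_map_pmf_eq[of fst "pair_pmf p1 p2" V] integrable_map_pmf_eq[of snd "pair_pmf p1 p2" V]
  by (simp_all add: map_fst_pair_pmf map_snd_pair_pmf)

text \<open>
  Draw \<open>u\<close> and \<open>v\<close> independently from the two distributions. The weighted distance counts for
  nothing when they coincide; of this gain only the event \<open>u = v = a\<close> is used.
\<close>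

lemma independent_coupling_bound:
  fixes f V :: "'a \<Rightarrow> real"
  assumes int: "integrable (measure_pmf p1) V" "integrable (measure_pmf p2) V"
    and V: "\<And>y. 0 \<le> V y" and f: "\<And>y. \<bar>f y\<bar> \<le> B" and c: "c \<ge> 0" and \<beta>: "\<beta> \<ge> 0"
    and lip: "\<And>u v. u \<noteq> v \<Longrightarrow> \<bar>f u - f v\<bar> \<le> c * (2 + \<beta> * (V u + V v))"
  shows "\<bar>measure_pmf.expectation p1 f - measure_pmf.expectation p2 f\<bar>
    \<le> c * (2 - 2 * (pmf p1 a * pmf p2 a) + \<beta> * (measure_pmf.expectation p1 V + measure_pmf.expectation p2 V))"
proof -
  let ?Q = "pair_pmf p1 p2"
  note fi = integrable_pmf_bounded[where f=f and B=B, OF f]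
  note fQ = integrable_pair_fst_snd[OF fi[of p1] fi[of p2]]
  note VQ = integrable_pair_fst_snd[OF int]
  have ind: "integrable (measure_pmf ?Q) (indicator {(a, a)} :: _ \<Rightarrow> real)"
    by (rule integrable_pmf_bounded[where B=1]) (auto simp: indicator_def)
  have "measure_pmf.expectation p1 f - measure_pmf.expectation p2 f
      = measure_pmf.expectation ?Q (\<lambda>z. f (fst z) - f (snd z))"
    using fQ by (simp add: Bochner_Integration.integral_diff)
  also have "\<bar>\<dots>\<bar> \<le> measure_pmf.expectation ?Q (\<lambda>z. \<bar>f (fst z) - f (snd z)\<bar>)"
    by (rule integral_abs_bound)
  also have "\<dots> \<le> measure_pmf.expectation ?Q
      (\<lambda>z. c * (2 - 2 * indicator {(a, a)} z + \<beta> * (V (fst z) + V (snd z))))"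
  proof (rule integral_mono)
    show "integrable (measure_pmf ?Q) (\<lambda>z. c * (2 - 2 * indicator {(a, a)} z + \<beta> * (V (fst z) + V (snd z))))"
      using VQ ind by auto
    show "\<bar>f (fst z) - f (snd z)\<bar> \<le> c * (2 - 2 * indicator {(a, a)} z + \<beta> * (V (fst z) + V (snd z)))" for z
    proof (cases "fst z = snd z")
      case True
      then show ?thesis using c \<beta> V by (auto simp: indicator_def)
    next
      case False
      then show ?thesis using lip[OF False] by (auto simp: indicator_def)
    qed
  qed (use fQ in auto)
  also have "\<dots> = c * (2 - 2 * (pmf p1 a * pmf p2 a) + \<beta> * (measure_pmf.expectation p1 V + measure_pmf.expectation p2 V))"
    using VQ ind by (simp add: measure_pmf_single pmf_pair)
  finally show ?thesis .
qed

lemma finite_set_carries_most_mass: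
  fixes p :: "'a pmf"
  assumes "\<epsilon> > 0"
  shows "\<exists>A. finite A \<and> (\<Sum>y\<in>A. pmf p y) > 1 - \<epsilon>"
proof -
  define A where "A n = {x \<in> set_pmf p. to_nat_on (set_pmf p) x < n}" for n
  have fin: "finite (A n)" for n
  proof -
    have "finite (to_nat_on (set_pmf p) ` A n)" by (rule finite_subset[of _ "{..<n}"]) (auto simp: A_def)
    moreover have "inj_on (to_nat_on (set_pmf p)) (A n)"
      by (rule inj_on_subset[OF inj_on_to_nat_on[OF countable_set_pmf[of p]]]) (auto simp: A_def)
    ultimately show ?thesis by (rule finite_imageD)
  qed
  have "(\<lambda>n. measure_pmf.prob p (A n)) \<longlonglongrightarrow> measure_pmf.prob p (\<Union>n. A n)"
    by (rule measure_pmf.finite_Lim_measure_incseq) (auto simp: incseq_def A_def)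
  moreover have "(\<Union>n. A n) = set_pmf p" by (auto simp: A_def)
  ultimately have "(\<lambda>n. measure_pmf.prob p (A n)) \<longlonglongrightarrow> 1"
    by (simp add: measure_pmf.prob_eq_1[THEN iffD2] AE_measure_pmf)
  then have "eventually (\<lambda>n. measure_pmf.prob p (A n) > 1 - \<epsilon>) sequentially"
    using assms by (intro order_tendstoD(1)) auto
  then obtain n where "measure_pmf.prob p (A n) > 1 - \<epsilon>" by (auto simp: eventually_sequentially)
  then show ?thesis using fin[of n] by (auto simp: measure_measure_pmf_finite)
qed

text \<open>
  Uniformity over all sets \<open>A\<close> is what keeps mass from escaping: a finite set that carries most
  of one distribution of the sequence carries most of all later ones, hence of the limit.
\<close>

lemma pmf_limit_exists:
  fixes p :: "nat \<Rightarrow> 'a pmf"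
  assumes cauchy: "\<And>\<epsilon>. \<epsilon> > 0 \<Longrightarrow> \<exists>n0. \<forall>n\<ge>n0. \<forall>A. \<bar>measure_pmf.prob (p n) A - measure_pmf.prob (p n0) A\<bar> \<le> \<epsilon>"
  shows "\<exists>\<pi>. \<forall>z. (\<lambda>n. pmf (p n) z) \<longlonglongrightarrow> pmf \<pi> z"
proof -
  have "Cauchy (\<lambda>n. pmf (p n) z)" for z
  proof (rule CauchyI')
    fix e :: real assume "e > 0"
    then obtain n0 where n0: "\<And>n A. n \<ge> n0 \<Longrightarrow> \<bar>measure_pmf.prob (p n) A - measure_pmf.prob (p n0) A\<bar> \<le> e / 3"
      using cauchy[of "e / 3"] by auto
    have "dist (pmf (p m) z) (pmf (p n) z) < e" if "m \<ge> n0" "n > m" for m n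
      using n0[of m "{z}"] n0[of n "{z}"] that \<open>e > 0\<close>
      unfolding measure_pmf_single dist_real_def by linarith
    then show "\<exists>M. \<forall>m\<ge>M. \<forall>n>m. dist (pmf (p m) z) (pmf (p n) z) < e" by blast
  qed
  then have "\<exists>l. (\<lambda>n. pmf (p n) z) \<longlonglongrightarrow> l" for z
    by (simp add: Cauchy_convergent_iff convergent_def)
  then obtain l where l: "\<And>z. (\<lambda>n. pmf (p n) z) \<longlonglongrightarrow> l z" by metis
  have l0: "l z \<ge> 0" for z by (rule LIMSEQ_le_const[OF l]) auto
  have le: "(\<integral>\<^sup>+z. ennreal (l z) \<partial>count_space UNIV) \<le> 1"
  proof -
    have "ennreal (l z) = liminf (\<lambda>n. ennreal (pmf (p n) z))" for z
      using lim_imp_Liminf[OF trivial_limit_sequentially tendsto_ennrealI[OF l[of z]]] by simp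
    then have "(\<integral>\<^sup>+z. ennreal (l z) \<partial>count_space UNIV)
        = (\<integral>\<^sup>+z. liminf (\<lambda>n. ennreal (pmf (p n) z)) \<partial>count_space UNIV)" by simp
    also have "\<dots> \<le> liminf (\<lambda>n. \<integral>\<^sup>+z. ennreal (pmf (p n) z) \<partial>count_space UNIV)"
      by (rule nn_integral_liminf) auto
    also have "\<dots> = 1" by (simp add: nn_integral_pmf_eq_1 Liminf_const)
    finally show ?thesis .
  qed
  have ge: "ennreal (1 - \<epsilon>) \<le> (\<integral>\<^sup>+z. ennreal (l z) \<partial>count_space UNIV)" if "\<epsilon> > 0" for \<epsilon>
  proof -
    obtain n0 where n0: "\<And>n A. n \<ge> n0 \<Longrightarrow> \<bar>measure_pmf.prob (p n) A - measure_pmf.prob (p n0) A\<bar> \<le> \<epsilon> / 2"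
      using cauchy[of "\<epsilon> / 2"] \<open>\<epsilon> > 0\<close> by auto
    obtain A where A: "finite A" "(\<Sum>y\<in>A. pmf (p n0) y) > 1 - \<epsilon> / 2"
      using finite_set_carries_most_mass[of "\<epsilon> / 2" "p n0"] \<open>\<epsilon> > 0\<close> by auto
    have "1 - \<epsilon> \<le> (\<Sum>z\<in>A. l z)"
    proof (rule LIMSEQ_le_const)
      show "(\<lambda>n. \<Sum>z\<in>A. pmf (p n) z) \<longlonglongrightarrow> (\<Sum>z\<in>A. l z)" by (intro tendsto_sum l)
      have "1 - \<epsilon> \<le> (\<Sum>z\<in>A. pmf (p n) z)" if "n \<ge> n0" for n
        using n0[OF that, of A] A(2) unfolding measure_measure_pmf_finite[OF A(1)] by linarith
      then show "\<exists>N. \<forall>n\<ge>N. 1 - \<epsilon> \<le> (\<Sum>z\<in>A. pmf (p n) z)" by blast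
    qed
    then have "ennreal (1 - \<epsilon>) \<le> (\<Sum>z\<in>A. ennreal (l z))"
      using l0 by (simp add: sum_ennreal ennreal_leI)
    also have "\<dots> = (\<integral>\<^sup>+z. ennreal (l z) \<partial>count_space A)"
      using A by (simp add: nn_integral_count_space_finite)
    also have "\<dots> = (\<integral>\<^sup>+z. ennreal (l z) * indicator A z \<partial>count_space UNIV)"
      by (simp add: nn_integral_count_space_indicator)
    also have "\<dots> \<le> (\<integral>\<^sup>+z. ennreal (l z) \<partial>count_space UNIV)"
      by (intro nn_integral_mono) (auto simp: indicator_def)
    finally show ?thesis .
  qed
  have "(\<integral>\<^sup>+z. ennreal (l z) \<partial>count_space UNIV) \<ge> 1"
  proof (rule ennreal_le_epsilon)
    fix e :: real assume "e > 0"
    have "(1::ennreal) \<le> ennreal (1 - e) + ennreal e"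
      using \<open>e > 0\<close> by (cases "e \<le> 1") (auto simp: ennreal_plus[symmetric] ennreal_neg simp del: ennreal_plus intro!: ennreal_leI simp flip: ennreal_1)
    also have "\<dots> \<le> (\<integral>\<^sup>+z. ennreal (l z) \<partial>count_space UNIV) + ennreal e"
      using ge[OF \<open>e > 0\<close>] by (intro add_right_mono)
    finally show "1 \<le> (\<integral>\<^sup>+z. ennreal (l z) \<partial>count_space UNIV) + ennreal e" .
  qed
  with le have "(\<integral>\<^sup>+z. ennreal (l z) \<partial>count_space UNIV) = 1" by (rule antisym)
  then have "pmf (embed_pmf l) z = l z" for z using l0 by (intro pmf_embed_pmf) auto
  then show ?thesis using l by (intro exI[of _ "embed_pmf l"]) simp
qed

text \<open>
  Pointwise convergence suffices (Scheffe) because the limit is a probability distribution: a finite set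
  carrying most of the limit eventually carries most of the approximating distributions.
\<close>

lemma expectation_tendsto_of_pmf_tendsto:
  fixes f :: "'a \<Rightarrow> real"
  assumes lim: "\<And>z. (\<lambda>n. pmf (p n) z) \<longlonglongrightarrow> pmf \<pi> z" and f: "\<And>y. \<bar>f y\<bar> \<le> B"
  shows "(\<lambda>n. measure_pmf.expectation (p n) f) \<longlonglongrightarrow> measure_pmf.expectation \<pi> f"
proof (rule LIMSEQ_I)
  fix e :: real assume "e > 0"
  have B: "B \<ge> 0" using f abs_ge_zero order_trans by blast
  define \<epsilon> where "\<epsilon> = e / (4 * (B + 1))"
  have \<epsilon>: "\<epsilon> > 0" using \<open>e > 0\<close> B by (simp add: \<epsilon>_def)
  have B\<epsilon>: "B * \<epsilon> < e / 4"
  proof -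
    have "B * \<epsilon> < (B + 1) * \<epsilon>" using \<epsilon> by simp
    also have "\<dots> = e / 4" using B by (simp add: \<epsilon>_def field_simps)
    finally show ?thesis .
  qed
  obtain A where A: "finite A" "(\<Sum>y\<in>A. pmf \<pi> y) > 1 - \<epsilon>"
    using finite_set_carries_most_mass[OF \<epsilon>] by blast
  have "(\<lambda>n. \<Sum>y\<in>A. pmf (p n) y) \<longlonglongrightarrow> (\<Sum>y\<in>A. pmf \<pi> y)" by (intro tendsto_sum lim)
  then have ev1: "eventually (\<lambda>n. (\<Sum>y\<in>A. pmf (p n) y) > 1 - \<epsilon>) sequentially"
    using A by (intro order_tendstoD(1))
  have "(\<lambda>n. \<Sum>y\<in>A. pmf (p n) y * f y) \<longlonglongrightarrow> (\<Sum>y\<in>A. pmf \<pi> y * f y)" by (intro tendsto_intros lim)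
  then have ev2: "eventually (\<lambda>n. dist (\<Sum>y\<in>A. pmf (p n) y * f y) (\<Sum>y\<in>A. pmf \<pi> y * f y) < e / 4) sequentially"
    using \<open>e > 0\<close> by (intro tendstoD) auto
  have tail: "\<bar>measure_pmf.expectation p' f - (\<Sum>y\<in>A. pmf p' y * f y)\<bar> < e / 4"
    if "(\<Sum>y\<in>A. pmf p' y) > 1 - \<epsilon>" for p'
  proof -
    have "\<bar>measure_pmf.expectation p' f - (\<Sum>y\<in>A. pmf p' y * f y)\<bar> \<le> B * (1 - (\<Sum>y\<in>A. pmf p' y))"
      by (rule expectation_finite_approx[OF A(1) f])
    also have "\<dots> \<le> B * \<epsilon>" using that B by (intro mult_left_mono) auto
    finally show ?thesis using B\<epsilon> by linarith
  qed
  have "eventually (\<lambda>n. norm (measure_pmf.expectation (p n) f - measure_pmf.expectation \<pi> f) < e) sequentially"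
    using ev1 ev2
  proof eventually_elim
    case (elim n)
    then show ?case using tail[OF elim(1)] tail[OF A(2)] \<open>e > 0\<close> unfolding dist_real_def real_norm_def by linarith
  qed
  then show "\<exists>no. \<forall>n\<ge>no. norm (measure_pmf.expectation (p n) f - measure_pmf.expectation \<pi> f) < e"
    by (simp add: eventually_sequentially)
qed

section \<open>Contraction and convergence to stationarity\<close>

locale lyapunov_chain = finite_rate_chain P q N
  for P :: "real \<Rightarrow> 's \<Rightarrow> 's pmf" and q N +
  fixes V :: "'s \<Rightarrow> real" and \<gamma> b :: real and a :: 's
  assumes V_nonneg: "0 \<le> V x" and V_sublevel: "finite {x. V x \<le> R}"
    and \<gamma>_pos: "\<gamma> > 0" and b_pos: "b > 0"
    and gen_V: "gen V x \<le> b - \<gamma> * V x"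
    and reach: "t > 0 \<Longrightarrow> a \<in> set_pmf (P t x)"
begin

abbreviation "EV t x \<equiv> measure_pmf.expectation (P t x) V"

lemma integrable_V: "t \<ge> 0 \<Longrightarrow> integrable (measure_pmf (P t x)) V"
  and EV_le: "t \<ge> 0 \<Longrightarrow> EV t x \<le> exp (- \<gamma> * t) * V x + b / \<gamma>"
  using expectation_lyapunov[where V=V and \<gamma>=\<gamma> and b=b] V_nonneg V_sublevel \<gamma>_pos b_pos gen_V
  by (auto simp: less_imp_le)

lemma EV_le': "t \<ge> 0 \<Longrightarrow> EV t x \<le> V x + b / \<gamma>"
proof -
  assume t: "t \<ge> 0"
  have "exp (- \<gamma> * t) * V x \<le> 1 * V x" using \<gamma>_pos t V_nonneg by (intro mult_right_mono) auto
  then show ?thesis using EV_le[OF t, of x] by simp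
qed

lemma minorization:
  obtains \<epsilon> where "\<epsilon> > 0" "\<And>x. V x \<le> R \<Longrightarrow> pmf (P 1 x) a \<ge> \<epsilon>"
proof -
  define S where "S = (\<lambda>x. pmf (P 1 x) a) ` insert a {x. V x \<le> R}"
  have S: "finite S" "S \<noteq> {}" using V_sublevel by (auto simp: S_def)
  have "Min S \<in> S" using S by (rule Min_in)
  then have "Min S > 0" using reach[of 1] by (auto simp: S_def pmf_positive_iff)
  moreover have "pmf (P 1 x) a \<ge> Min S" if "V x \<le> R" for x
    using S that by (intro Min_le) (auto simp: S_def)
  ultimately show ?thesis using that by blast
qed

text \<open>
  The right-hand factor is the weighted distance of \<open>u\<close> and \<open>v\<close>, the left-hand side its bound
  after a unit of time. If \<open>V(u) + V(v)\<close> is large, the decrease of \<open>V\<close> outweighs both the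
  constant 2 and the additive term \<open>b / \<gamma>\<close>. If it is small, both states lie in a finite set
  from which \<open>a\<close> is hit with probability at least \<open>\<epsilon>\<close>, and \<open>\<beta>\<close> is chosen so small that the
  additive term costs only half of the gain \<open>2 \<epsilon>\<^sup>2\<close>.
\<close>

lemma one_step_contraction:
  "\<exists>\<beta> \<alpha>. \<beta> > 0 \<and> 0 < \<alpha> \<and> \<alpha> < 1 \<and> (\<forall>u v.
    2 - 2 * (pmf (P 1 u) a * pmf (P 1 v) a) + \<beta> * (EV 1 u + EV 1 v) \<le> \<alpha> * (2 + \<beta> * (V u + V v)))"
proof -
  define \<alpha>0 where "\<alpha>0 = exp (- \<gamma>)"
  define B where "B = b / \<gamma>"
  define R where "R = 8 * B / (1 - \<alpha>0)"
  have \<alpha>0: "0 < \<alpha>0" "\<alpha>0 < 1" using \<gamma>_pos by (auto simp: \<alpha>0_def)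
  have B: "B > 0" using b_pos \<gamma>_pos by (simp add: B_def)
  have RB: "R * (1 - \<alpha>0) = 8 * B" using \<alpha>0 by (simp add: R_def)
  obtain \<epsilon> where \<epsilon>: "\<epsilon> > 0" "\<And>x. V x \<le> R \<Longrightarrow> pmf (P 1 x) a \<ge> \<epsilon>" using minorization by blast
  \<comment> \<open>With \<open>\<beta> B = \<epsilon>\<^sup>2 / 2\<close>, the additive term \<open>2 \<beta> B\<close> uses up \<open>\<epsilon>\<^sup>2\<close> of the gain \<open>2 \<epsilon>\<^sup>2\<close>, and
    the choice of \<open>R\<close> makes \<open>\<beta> R (1 - \<alpha>0) = 4 \<epsilon>\<^sup>2\<close>.\<close>
  define \<beta> where "\<beta> = \<epsilon>\<^sup>2 / (2 * B)"
  define \<alpha> where "\<alpha> = max ((1 + \<alpha>0) / 2) (1 - \<epsilon>\<^sup>2 / 2)"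
  have \<beta>: "\<beta> > 0" "\<beta> * B = \<epsilon>\<^sup>2 / 2" using B \<epsilon> by (auto simp: \<beta>_def)
  have \<alpha>: "0 < \<alpha>" "\<alpha> < 1" "\<alpha> \<ge> (1 + \<alpha>0) / 2" "\<alpha> \<ge> 1 - \<epsilon>\<^sup>2 / 2"
    using \<alpha>0 \<epsilon> by (auto simp: \<alpha>_def less_max_iff_disj)
  have "2 - 2 * (pmf (P 1 u) a * pmf (P 1 v) a) + \<beta> * (EV 1 u + EV 1 v) \<le> \<alpha> * (2 + \<beta> * (V u + V v))" for u v
  proof -
    define s where "s = V u + V v"
    have s0: "s \<ge> 0" using V_nonneg by (simp add: s_def)
    have "EV 1 u + EV 1 v \<le> \<alpha>0 * s + 2 * B"
      using EV_le[of 1 u] EV_le[of 1 v] by (simp add: \<alpha>0_def s_def algebra_simps flip: B_def)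
    then have "\<beta> * (EV 1 u + EV 1 v) \<le> \<beta> * (\<alpha>0 * s + 2 * B)"
      using \<beta> by (intro mult_left_mono) auto
    then have EV: "\<beta> * (EV 1 u + EV 1 v) \<le> \<beta> * s * \<alpha>0 + \<epsilon>\<^sup>2" using \<beta>(2) by (simp add: algebra_simps)
    show ?thesis
    proof (cases "s \<ge> R")
      case True
      have "4 * \<epsilon>\<^sup>2 = \<beta> * (R * (1 - \<alpha>0))" using \<beta>(2) by (simp add: RB mult_ac)
      also have "\<dots> \<le> \<beta> * (s * (1 - \<alpha>0))"
        using True \<alpha>0 \<beta> by (intro mult_left_mono mult_right_mono) auto
      finally have "2 * \<epsilon>\<^sup>2 \<le> \<beta> * s * ((1 - \<alpha>0) / 2)" by simp
      also have "\<dots> \<le> \<beta> * s * (\<alpha> - \<alpha>0)"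
        using \<alpha> \<beta> s0 by (intro mult_left_mono) auto
      finally have "2 * \<epsilon>\<^sup>2 + \<beta> * s * \<alpha>0 \<le> \<alpha> * (\<beta> * s)" by (simp add: algebra_simps)
      moreover have "pmf (P 1 u) a * pmf (P 1 v) a \<ge> 0" by simp
      ultimately show ?thesis using EV \<alpha>(4) zero_le_power2[of \<epsilon>]
        unfolding s_def[symmetric] distrib_left by linarith
    next
      case False
      then have "V u \<le> R" "V v \<le> R" using V_nonneg[of u] V_nonneg[of v] by (auto simp: s_def)
      then have "\<epsilon> * \<epsilon> \<le> pmf (P 1 u) a * pmf (P 1 v) a"
        using \<epsilon> by (intro mult_mono) (auto simp: less_imp_le)
      moreover have "\<beta> * s * \<alpha>0 \<le> \<beta> * s * \<alpha>"
        using \<alpha> \<alpha>0 \<beta> s0 by (intro mult_left_mono) auto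
      ultimately show ?thesis using EV \<alpha>(4) by (simp add: s_def[symmetric] distrib_left power2_eq_square mult_ac)
    qed
  qed
  with \<beta>(1) \<alpha>(1,2) show ?thesis by blast
qed

text \<open>
  Iterating the one-step contraction over the integer part of \<open>t\<close>. The fractional part can go
  into the initial function, as any function with values in \<open>[0, 1]\<close> has oscillation at most
  1.
\<close>

lemma evolve_contraction:
  "\<exists>\<beta> K \<kappa>. \<beta> > 0 \<and> K > 0 \<and> \<kappa> > 0 \<and> (\<forall>f t u v. (\<forall>y. 0 \<le> f y \<and> f y \<le> 1) \<longrightarrow> 0 \<le> t \<longrightarrow>
    \<bar>evolve f t u - evolve f t v\<bar> \<le> K * exp (- \<kappa> * t) * (2 + \<beta> * (V u + V v)))"
proof -
  obtain \<beta> \<alpha> where \<beta>: "\<beta> > 0" and \<alpha>: "0 < \<alpha>" "\<alpha> < 1" and step: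
    "\<And>u v. 2 - 2 * (pmf (P 1 u) a * pmf (P 1 v) a) + \<beta> * (EV 1 u + EV 1 v) \<le> \<alpha> * (2 + \<beta> * (V u + V v))"
    using one_step_contraction by blast
  have iter: "\<bar>evolve f (real n + r) u - evolve f (real n + r) v\<bar> \<le> \<alpha> ^ n * (2 + \<beta> * (V u + V v))"
    if f: "\<And>y. 0 \<le> f y" "\<And>y. f y \<le> 1" and r: "r \<ge> 0" for f n r u v
  proof (induction n arbitrary: u v)
    case 0
    have "\<beta> * (V u + V v) \<ge> 0" using \<beta> V_nonneg by simp
    then show ?case using evolve_bounds[of f 1 r u, OF f] evolve_bounds[of f 1 r v, OF f] by simp
  next
    case (Suc n)
    have eq: "evolve f (real (Suc n) + r) x = measure_pmf.expectation (P 1 x) (evolve f (real n + r))" for x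
      using evolve_add[of f 1 1 "real n + r" x, OF f] r by (simp add: algebra_simps)
    have "\<bar>evolve f (real (Suc n) + r) u - evolve f (real (Suc n) + r) v\<bar>
        \<le> \<alpha> ^ n * (2 - 2 * (pmf (P 1 u) a * pmf (P 1 v) a) + \<beta> * (EV 1 u + EV 1 v))"
      unfolding eq
    proof (rule independent_coupling_bound[where B=1])
      show "\<bar>evolve f (real n + r) y\<bar> \<le> 1" for y using evolve_bounds[of f 1 _ y, OF f] by simp
    qed (use integrable_V[of 1] V_nonneg \<alpha> \<beta> Suc in auto)
    also have "\<dots> \<le> \<alpha> ^ n * (\<alpha> * (2 + \<beta> * (V u + V v)))"
      using \<alpha> by (intro mult_left_mono step) auto
    finally show ?case by (simp add: mult_ac)
  qed
  define \<kappa> where "\<kappa> = - ln \<alpha>"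
  have \<kappa>: "\<kappa> > 0" using \<alpha> by (simp add: \<kappa>_def)
  have "\<bar>evolve f t u - evolve f t v\<bar> \<le> 1 / \<alpha> * exp (- \<kappa> * t) * (2 + \<beta> * (V u + V v))"
    if f: "\<forall>y. 0 \<le> f y \<and> f y \<le> 1" and t: "0 \<le> t" for f t u v
  proof -
    define n where "n = nat \<lfloor>t\<rfloor>"
    have n: "real n \<le> t" "t \<le> real n + 1" using t by (auto simp: n_def)
    have "\<alpha> ^ n = exp (- \<kappa> * real n)" using \<alpha> by (simp add: \<kappa>_def exp_of_nat2_mult)
    also have "\<dots> \<le> exp (- \<kappa> * (t - 1))" using n \<kappa> by simp
    also have "\<dots> = exp (- \<kappa> * t) * exp \<kappa>" by (simp add: algebra_simps flip: exp_add)
    also have "exp \<kappa> = 1 / \<alpha>" using \<alpha> by (simp add: \<kappa>_def exp_minus inverse_eq_divide)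
    finally have pow: "\<alpha> ^ n \<le> 1 / \<alpha> * exp (- \<kappa> * t)" by simp
    have "\<bar>evolve f t u - evolve f t v\<bar> \<le> \<alpha> ^ n * (2 + \<beta> * (V u + V v))"
      using iter[of f "t - real n" n u v] f n by simp
    also have "\<dots> \<le> 1 / \<alpha> * exp (- \<kappa> * t) * (2 + \<beta> * (V u + V v))"
      using pow \<beta> V_nonneg by (intro mult_right_mono) auto
    finally show ?thesis .
  qed
  then show ?thesis using \<beta> \<kappa> \<alpha> by (intro exI[of _ \<beta>] exI[of _ "1 / \<alpha>"] exI[of _ \<kappa>]) auto
qed

text \<open>
  The law at time \<open>s + t\<close> is that at time \<open>t\<close> started from the law at time \<open>s\<close>, so the contraction
  applies to the starting points \<open>x\<close> and \<open>X\<^sub>s\<close>; the bound is uniform in \<open>s\<close> because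
  \<open>E\<^sub>x V(X\<^sub>s)\<close> is.
\<close>

lemma evolve_cauchy:
  "\<exists>C \<kappa>. C > 0 \<and> \<kappa> > 0 \<and> (\<forall>f s t. (\<forall>y. 0 \<le> f y \<and> f y \<le> 1) \<longrightarrow> 0 \<le> s \<longrightarrow> 0 \<le> t \<longrightarrow>
    \<bar>evolve f (s + t) x - evolve f t x\<bar> \<le> C * exp (- \<kappa> * t))"
proof -
  obtain \<beta> K \<kappa> where \<beta>: "\<beta> > 0" and K: "K > 0" and \<kappa>: "\<kappa> > 0" and contr:
    "\<And>f t u v. (\<forall>y. 0 \<le> f y \<and> f y \<le> 1) \<Longrightarrow> 0 \<le> t \<Longrightarrow>
      \<bar>evolve f t u - evolve f t v\<bar> \<le> K * exp (- \<kappa> * t) * (2 + \<beta> * (V u + V v))"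
    using evolve_contraction by blast
  define D where "D = 2 + \<beta> * (2 * V x + b / \<gamma>)"
  have D: "D > 0" unfolding D_def using \<beta> V_nonneg[of x] b_pos \<gamma>_pos by (intro add_pos_nonneg) auto
  have "\<bar>evolve f (s + t) x - evolve f t x\<bar> \<le> K * D * exp (- \<kappa> * t)"
    if f: "\<forall>y. 0 \<le> f y \<and> f y \<le> 1" and st: "0 \<le> s" "0 \<le> t" for f s t
  proof -
    have "evolve f (s + t) x - evolve f t x
        = measure_pmf.expectation (P s x) (\<lambda>y. evolve f t y - evolve f t x)"
      using f st by (intro evolve_increment[where B=1]) auto
    also have "\<bar>\<dots>\<bar> \<le> measure_pmf.expectation (P s x) (\<lambda>y. \<bar>evolve f t y - evolve f t x\<bar>)"
      by (rule integral_abs_bound)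
    also have "\<dots> \<le> measure_pmf.expectation (P s x) (\<lambda>y. K * exp (- \<kappa> * t) * (2 + \<beta> * (V y + V x)))"
    proof (rule integral_mono)
      have b: "0 \<le> evolve f t y" "evolve f t y \<le> 1" for y using evolve_bounds[of f 1 t y] f by auto
      have "\<bar>\<bar>evolve f t y - evolve f t x\<bar>\<bar> \<le> 1" for y using b[of x] b[of y] by linarith
      then show "integrable (measure_pmf (P s x)) (\<lambda>y. \<bar>evolve f t y - evolve f t x\<bar>)"
        by (rule integrable_pmf_bounded)
    qed (use integrable_V[OF st(1), of x] contr[OF f st(2)] in auto)
    also have "\<dots> = K * exp (- \<kappa> * t) * (2 + \<beta> * (EV s x + V x))"
      using integrable_V[OF st(1), of x] by simp
    also have "\<dots> \<le> K * exp (- \<kappa> * t) * D"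
    proof (rule mult_left_mono)
      have "EV s x + V x \<le> 2 * V x + b / \<gamma>" using EV_le'[OF st(1), of x] by linarith
      then show "2 + \<beta> * (EV s x + V x) \<le> D" unfolding D_def using \<beta> by simp
    qed (use K in auto)
    finally show ?thesis by (simp add: mult_ac)
  qed
  then show ?thesis using K D \<kappa> by (intro exI[of _ "K * D"] exI[of _ \<kappa>]) auto
qed

lemma evolve_indicator: "evolve (indicator A) t x = measure_pmf.prob (P t x) A"
  by (simp add: evolve_def)

text \<open>
  The limit \<open>\<pi>\<close> of the laws at integer times is also the limit along every shifted sequence and
  from every starting point. Stationarity and uniqueness then both follow by passing to the
  limit under an expectation, over the law at time \<open>n\<close> in the first case and over the competing
  stationary distribution in the second.
\<close>

theorem exponential_ergodicity:
  "\<exists>\<pi>. (\<forall>\<rho>. stationary_distribution P \<rho> \<longleftrightarrow> \<rho> = \<pi>) \<and>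
    (\<exists>K3>0. \<exists>K4>0. \<forall>x. \<forall>t\<ge>0. \<bar>pmf (P t a) x - pmf \<pi> x\<bar> \<le> K3 * exp (- K4 * t))"
proof -
  obtain C \<kappa> where C: "C > 0" and \<kappa>: "\<kappa> > 0" and "\<forall>f s t. (\<forall>y. 0 \<le> f y \<and> f y \<le> 1) \<longrightarrow> 0 \<le> s \<longrightarrow> 0 \<le> t \<longrightarrow>
      \<bar>evolve f (s + t) a - evolve f t a\<bar> \<le> C * exp (- \<kappa> * t)"
    using evolve_cauchy[of a] by blast
  then have prob: "\<bar>measure_pmf.prob (P (s + t) a) A - measure_pmf.prob (P t a) A\<bar> \<le> C * exp (- \<kappa> * t)"
    if "0 \<le> s" "0 \<le> t" for s t A
    using that unfolding evolve_indicator[symmetric] by (auto simp: indicator_def)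
  have point: "\<bar>pmf (P (s + t) a) z - pmf (P t a) z\<bar> \<le> C * exp (- \<kappa> * t)" if "0 \<le> s" "0 \<le> t" for s t z
    using prob[OF that, of "{z}"] by (simp add: measure_pmf_single)
  have decay: "(\<lambda>n. C * exp (- \<kappa> * real n)) \<longlonglongrightarrow> 0"
  proof -
    have "(\<lambda>n. C * exp (- \<kappa>) ^ n) \<longlonglongrightarrow> C * 0"
      using \<kappa> by (intro tendsto_intros LIMSEQ_power_zero) auto
    then show ?thesis by (simp add: exp_of_nat2_mult[symmetric])
  qed
  have "\<exists>\<pi>. \<forall>z. (\<lambda>n. pmf (P (real n) a) z) \<longlonglongrightarrow> pmf \<pi> z"
  proof (rule pmf_limit_exists)
    fix \<epsilon> :: real assume "\<epsilon> > 0"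
    then obtain n0 where n0: "C * exp (- \<kappa> * real n0) < \<epsilon>"
      using order_tendstoD(2)[OF decay] by (auto simp: eventually_sequentially)
    have "\<bar>measure_pmf.prob (P (real n) a) A - measure_pmf.prob (P (real n0) a) A\<bar> \<le> \<epsilon>" if "n \<ge> n0" for n A
      using prob[of "real n - real n0" "real n0" A] that n0 by simp
    then show "\<exists>n0. \<forall>n\<ge>n0. \<forall>A. \<bar>measure_pmf.prob (P (real n) a) A - measure_pmf.prob (P (real n0) a) A\<bar> \<le> \<epsilon>"
      by blast
  qed
  then obtain \<pi> where \<pi>: "\<And>z. (\<lambda>n. pmf (P (real n) a) z) \<longlonglongrightarrow> pmf \<pi> z" by blast
  have rate: "\<bar>pmf (P t a) z - pmf \<pi> z\<bar> \<le> C * exp (- \<kappa> * t)" if "t \<ge> 0" for t z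
  proof (rule LIMSEQ_le_const2)
    show "(\<lambda>n. \<bar>pmf (P t a) z - pmf (P (real n) a) z\<bar>) \<longlonglongrightarrow> \<bar>pmf (P t a) z - pmf \<pi> z\<bar>"
      by (intro tendsto_intros \<pi>)
    have "\<bar>pmf (P t a) z - pmf (P (real n) a) z\<bar> \<le> C * exp (- \<kappa> * t)" if "n \<ge> nat \<lceil>t\<rceil>" for n
    proof -
      have "real n - t \<ge> 0" using that by linarith
      from point[OF this \<open>t \<ge> 0\<close>, of z] show ?thesis by (simp add: abs_minus_commute)
    qed
    then show "\<exists>N. \<forall>n\<ge>N. \<bar>pmf (P t a) z - pmf (P (real n) a) z\<bar> \<le> C * exp (- \<kappa> * t)" by blast
  qed
  have shifted: "(\<lambda>n. pmf (P (real n + s) x) z) \<longlonglongrightarrow> pmf \<pi> z" if "s \<ge> 0" for s x z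
  proof -
    obtain \<beta> K \<kappa>' where \<kappa>': "\<kappa>' > 0" and contr:
      "\<And>f t u v. (\<forall>y. 0 \<le> f y \<and> f y \<le> 1) \<Longrightarrow> 0 \<le> t \<Longrightarrow>
        \<bar>evolve f t u - evolve f t v\<bar> \<le> K * exp (- \<kappa>' * t) * (2 + \<beta> * (V u + V v))"
      using evolve_contraction by blast
    define L where "L = K * (2 + \<beta> * (V x + V a))"
    have c: "\<bar>pmf (P t x) z - pmf (P t a) z\<bar> \<le> L * exp (- \<kappa>' * t)" if "t \<ge> 0" for t
      using contr[of "indicator {z}" t x a] that
      by (simp add: evolve_indicator measure_pmf_single L_def mult_ac indicator_def)
    have dec: "((\<lambda>n. D * exp (- k * (real n + s))) \<longlonglongrightarrow> 0)" if "k > 0" for D k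
    proof -
      have "(\<lambda>n. D * exp (- k * s) * exp (- k) ^ n) \<longlonglongrightarrow> D * exp (- k * s) * 0"
        using that by (intro tendsto_intros LIMSEQ_power_zero) auto
      then show ?thesis by (simp add: exp_of_nat2_mult[symmetric] distrib_left exp_add[symmetric] exp_diff exp_minus field_simps)
    qed
    have "(\<lambda>n. L * exp (- \<kappa>' * (real n + s)) + C * exp (- \<kappa> * (real n + s))) \<longlonglongrightarrow> 0 + 0"
      by (intro tendsto_add dec \<kappa> \<kappa>')
    then have "(\<lambda>n. L * exp (- \<kappa>' * (real n + s)) + C * exp (- \<kappa> * (real n + s))) \<longlonglongrightarrow> 0" by simp
    then have "(\<lambda>n. pmf (P (real n + s) x) z - pmf \<pi> z) \<longlonglongrightarrow> 0"
    proof (rule Lim_null_comparison[rotated])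
      have "norm (pmf (P (real n + s) x) z - pmf \<pi> z)
          \<le> L * exp (- \<kappa>' * (real n + s)) + C * exp (- \<kappa> * (real n + s))" for n
        using c[of "real n + s"] rate[of "real n + s" z] \<open>s \<ge> 0\<close> by simp
      then show "\<forall>\<^sub>F n in sequentially. norm (pmf (P (real n + s) x) z - pmf \<pi> z)
          \<le> L * exp (- \<kappa>' * (real n + s)) + C * exp (- \<kappa> * (real n + s))" by simp
    qed
    then show ?thesis by (simp add: LIM_zero_iff)
  qed
  have "stationary_distribution P \<pi>"
    unfolding stationary_distribution_def
  proof (intro allI impI pmf_eqI)
    fix s :: real and z assume s: "s \<ge> 0"
    have "(\<lambda>n. measure_pmf.expectation (P (real n) a) (\<lambda>y. pmf (P s y) z)) \<longlonglongrightarrow> measure_pmf.expectation \<pi> (\<lambda>y. pmf (P s y) z)"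
      by (rule expectation_tendsto_of_pmf_tendsto[OF \<pi>, where B=1]) (simp add: pmf_le_1)
    then have "(\<lambda>n. pmf (P (real n + s) a) z) \<longlonglongrightarrow> pmf (bind_pmf \<pi> (P s)) z"
      using s by (simp add: P_add pmf_bind)
    with shifted[OF s, of a z] show "pmf (bind_pmf \<pi> (P s)) z = pmf \<pi> z" by (rule LIMSEQ_unique[rotated])
  qed
  moreover have "\<rho> = \<pi>" if \<rho>: "stationary_distribution P \<rho>" for \<rho>
  proof (rule pmf_eqI)
    fix z
    have "(\<lambda>n. measure_pmf.expectation \<rho> (\<lambda>y. pmf (P (real n) y) z)) \<longlonglongrightarrow> measure_pmf.expectation \<rho> (\<lambda>_. pmf \<pi> z)"
    proof (rule integral_dominated_convergence[where w="\<lambda>_. 1"])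
      show "AE y in measure_pmf \<rho>. (\<lambda>n. pmf (P (real n) y) z) \<longlonglongrightarrow> pmf \<pi> z"
        using shifted[of 0] by simp
    qed (auto simp: pmf_le_1)
    moreover have "measure_pmf.expectation \<rho> (\<lambda>y. pmf (P (real n) y) z) = pmf \<rho> z" for n
      using \<rho> by (simp add: stationary_distribution_def flip: pmf_bind)
    ultimately show "pmf \<rho> z = pmf \<pi> z" by (simp add: LIMSEQ_const_iff)
  qed
  ultimately show ?thesis using rate C \<kappa> by (intro exI[of _ \<pi>]) blast
qed

end

section \<open>The process of the allocation\<close>

definition neighbours :: "nat ^ 'n::finite \<Rightarrow> (nat ^ 'n) set" where
  "neighbours x = range (\<lambda>i. x + axis i 1) \<union> (\<lambda>i. x - axis i 1) ` {i. x $ i > 0}"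

lemma neighbours_basic:
  "finite (neighbours x)" "x \<notin> neighbours x"
  "y \<notin> neighbours x \<Longrightarrow> jump_rate lam \<phi> x y = 0"
proof -
  have "x \<noteq> x + axis i 1" for i by (auto simp: vec_eq_iff axis_def)
  moreover have "x \<noteq> x - axis i 1" if "x $ i > 0" for i
    using that by (auto simp: vec_eq_iff axis_def intro!: exI[of _ i])
  ultimately show "x \<notin> neighbours x" by (auto simp: neighbours_def)
qed (auto simp: neighbours_def jump_rate_def intro!: sum.neutral)

lemma sum_jump_rate_eq_generator:
  assumes zero: "\<And>i. x $ i = 0 \<Longrightarrow> \<phi> x i = 0"
  shows "(\<Sum>y\<in>neighbours x. jump_rate lam \<phi> x y * (f y - f x)) = generator lam \<phi> f x"
proof -
  let ?g = "\<lambda>y. f y - f x"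
  have "(\<Sum>y\<in>neighbours x. jump_rate lam \<phi> x y * ?g y) =
      (\<Sum>i\<in>UNIV. \<Sum>y\<in>neighbours x. (if y = x + axis i 1 then lam $ i * ?g y else 0) +
        (if y = x - axis i 1 then (if x $ i > 0 then \<phi> x i * ?g y else 0) else 0))"
    unfolding jump_rate_def sum_distrib_right
    by (subst sum.swap) (intro sum.cong refl, auto simp: distrib_right)
  also have "\<dots> = generator lam \<phi> f x"
    unfolding generator_def
  proof (rule sum.cong)
    fix i
    have "x + axis i 1 \<in> neighbours x" by (simp add: neighbours_def)
    moreover have "x $ i > 0 \<Longrightarrow> x - axis i 1 \<in> neighbours x" by (simp add: neighbours_def)
    ultimately show "(\<Sum>y\<in>neighbours x. (if y = x + axis i 1 then lam $ i * ?g y else 0) +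
        (if y = x - axis i 1 then (if x $ i > 0 then \<phi> x i * ?g y else 0) else 0))
      = lam $ i * ?g (x + axis i 1) + \<phi> x i * ?g (x - axis i 1)"
      using zero[of i] by (cases "x $ i = 0") (simp_all add: sum.distrib neighbours_basic(1))
  qed simp
  finally show ?thesis .
qed

lemma finite_sum_le:
  fixes K :: real
  shows "finite {x :: nat ^ 'n::finite. real (\<Sum>i\<in>UNIV. x $ i) \<le> K}"
proof (rule finite_subset)
  show "finite (vec_lambda ` (PiE UNIV (\<lambda>_. {..nat \<lfloor>K\<rfloor>})) :: (nat ^ 'n) set)"
    by (intro finite_imageI finite_PiE) auto
  have "x $ i \<le> nat \<lfloor>K\<rfloor>" if "real (\<Sum>i\<in>UNIV. x $ i) \<le> K" for x :: "nat ^ 'n" and i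
  proof -
    have "x $ i \<le> (\<Sum>i\<in>UNIV. x $ i)" by (rule member_le_sum) auto
    then show ?thesis using that by (simp only: le_nat_floor)
  qed
  then show "{x :: nat ^ 'n. real (\<Sum>i\<in>UNIV. x $ i) \<le> K} \<subseteq> vec_lambda ` (PiE UNIV (\<lambda>_. {..nat \<lfloor>K\<rfloor>}))"
    by (auto simp: image_iff simp del: of_nat_sum intro!: bexI[where x="vec_nth _"])
qed

text \<open>
  Every nonempty class is served at a positive rate, so a departure is always possible and lowers
  the total number; the origin is therefore reachable from everywhere.
\<close>

lemma mPF_descent:
  fixes x :: "nat ^ 'n::finite"
  assumes lam: "\<And>i. lam $ i > 0" and x: "x \<noteq> 0"
  shows "\<exists>y. y \<noteq> x \<and> jump_rate lam (mPF C) x y > 0 \<and> (\<Sum>i\<in>UNIV. y $ i) < (\<Sum>i\<in>UNIV. x $ i)"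
proof -
  obtain i where i: "x $ i > 0" using x by (auto simp: vec_eq_iff)
  define y where "y = x - axis i 1"
  have "y \<in> neighbours x" using i by (auto simp: y_def neighbours_def)
  then have "y \<noteq> x" using neighbours_basic(2) by metis
  have nn: "(if y = x + axis j 1 then lam $ j else 0) + (if x $ j > 0 \<and> y = x - axis j 1 then mPF C x j else 0) \<ge> 0" for j
    using lam[of j] by (auto simp: mPF_def)
  have "0 < mPF C x i" using i by (simp add: mPF_def)
  also have "\<dots> \<le> (if y = x + axis i 1 then lam $ i else 0) + (if x $ i > 0 \<and> y = x - axis i 1 then mPF C x i else 0)"
    using i lam[of i] by (simp add: y_def)
  also have "\<dots> \<le> jump_rate lam (mPF C) x y"
    unfolding jump_rate_def by (rule member_le_sum) (use nn in auto)
  finally have "jump_rate lam (mPF C) x y > 0" .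
  moreover have "(\<Sum>i\<in>UNIV. y $ i) < (\<Sum>i\<in>UNIV. x $ i)"
    by (rule sum_strict_mono_ex1) (use i in \<open>auto simp: y_def axis_def\<close>)
  ultimately show ?thesis using \<open>y \<noteq> x\<close> by blast
qed

lemma markov_process_cond_prob:
  assumes M: "markov_process M X P" and pos: "\<P>(\<omega> in M. X 0 \<omega> = a) > 0" and t: "t \<ge> 0"
  shows "\<P>(\<omega> in M. X t \<omega> = x \<bar> X 0 \<omega> = a) = pmf (P t a) x"
proof -
  have "\<forall>s u T \<xi> y. 0 \<le> s \<longrightarrow> s \<le> u \<longrightarrow> finite T \<longrightarrow> T \<subseteq> {0..s} \<longrightarrow>
        \<P>(\<omega> in M. (\<forall>r\<in>insert s T. X r \<omega> = \<xi> r) \<and> X u \<omega> = y) =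
        \<P>(\<omega> in M. \<forall>r\<in>insert s T. X r \<omega> = \<xi> r) * pmf (P (u - s) (\<xi> s)) y"
    using M unfolding markov_process_def by blast
  from this[rule_format, of 0 t "{}" "\<lambda>_. a" x]
  have "\<P>(\<omega> in M. X 0 \<omega> = a \<and> X t \<omega> = x) = \<P>(\<omega> in M. X 0 \<omega> = a) * pmf (P t a) x"
    using t by simp
  then show ?thesis using pos by (simp add: cond_prob_def conj_commute)
qed

text \<open>
  For the second part the drift is extended to all states by adding a constant: only finitely
  many states violate the drift inequality, so the sum of their excesses is a bound for each.
\<close>

theorem proposition6:
  fixes C :: "(real ^ 'n::finite) set" and lam :: "real ^ 'n"
    and M :: "'w measure" and X :: "real \<Rightarrow> 'w \<Rightarrow> nat ^ 'n"
    and P :: "real \<Rightarrow> nat ^ 'n \<Rightarrow> (nat ^ 'n) pmf"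
  assumes "capacity_set C" and "lam \<in> interior C"
  shows "(\<exists>\<delta>>0. \<exists>\<gamma>>0. \<exists>K::real. \<forall>x. real (\<Sum>i\<in>UNIV. x $ i) > K \<longrightarrow>
            generator lam (mPF C) (lyap_G lam \<delta>) x \<le> - \<gamma> * lyap_G lam \<delta> x) \<and>
         (markov_process M X P \<and> has_rates P (jump_rate lam (mPF C)) \<and>
          \<P>(\<omega> in M. X 0 \<omega> = 0) > 0 \<longrightarrow>
          (\<exists>\<pi>. (\<forall>\<rho>. stationary_distribution P \<rho> \<longleftrightarrow> \<rho> = \<pi>) \<and>
               (\<exists>K3>0. \<exists>K4>0. \<forall>x. \<forall>t\<ge>0.
                  \<bar>\<P>(\<omega> in M. X t \<omega> = x \<bar> X 0 \<omega> = 0) - pmf \<pi> x\<bar> \<le> K3 * exp (- K4 * t))))"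
proof -
  let ?q = "jump_rate lam (mPF C)"
  have lam: "\<And>i. lam $ i > 0" by (rule interior_capacity_set(1)[OF assms])
  obtain B c where "c > 0" "\<And>x i. 0 \<le> mPF C x i \<and> mPF C x i \<le> B"
    "\<And>x. (\<Sum>i\<in>UNIV. real (x $ i) * (1 - mPF C x i / lam $ i)) \<le> B - c * real (\<Sum>i\<in>UNIV. x $ i)"
    using mPF_drift[OF assms] by blast
  then have part1: "\<exists>\<delta>>0. \<exists>\<gamma>>0. \<exists>K::real. \<forall>x. real (\<Sum>i\<in>UNIV. x $ i) > K \<longrightarrow>
      generator lam (mPF C) (lyap_G lam \<delta>) x \<le> - \<gamma> * lyap_G lam \<delta> x"
    by (intro lyap_G_drift[OF lam, where B=B and c=c]) (auto simp: mPF_def)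
  then obtain \<delta> \<gamma> K where \<delta>: "\<delta> > 0" and \<gamma>: "\<gamma> > 0" and drift: "\<And>x. real (\<Sum>i\<in>UNIV. x $ i) > K \<Longrightarrow>
      generator lam (mPF C) (lyap_G lam \<delta>) x \<le> - \<gamma> * lyap_G lam \<delta> x" by blast
  define S where "S = {x :: nat ^ 'n. real (\<Sum>i\<in>UNIV. x $ i) \<le> K}"
  define excess where "excess x = \<bar>generator lam (mPF C) (lyap_G lam \<delta>) x + \<gamma> * lyap_G lam \<delta> x\<bar>" for x
  define b where "b = 1 + sum excess S"
  have S: "finite S" unfolding S_def by (rule finite_sum_le)
  have sum0: "sum excess S \<ge> 0" by (intro sum_nonneg) (simp add: excess_def)
  have gen: "generator lam (mPF C) (lyap_G lam \<delta>) x \<le> b - \<gamma> * lyap_G lam \<delta> x" for x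
  proof (cases "x \<in> S")
    case True
    then have "excess x \<le> sum excess S" using S by (intro member_le_sum) (auto simp: excess_def)
    then show ?thesis unfolding b_def excess_def by linarith
  next
    case False
    then show ?thesis using drift[of x] sum0 by (simp add: S_def b_def)
  qed
  have "\<exists>\<pi>. (\<forall>\<rho>. stationary_distribution P \<rho> \<longleftrightarrow> \<rho> = \<pi>) \<and>
      (\<exists>K3>0. \<exists>K4>0. \<forall>x. \<forall>t\<ge>0. \<bar>\<P>(\<omega> in M. X t \<omega> = x \<bar> X 0 \<omega> = 0) - pmf \<pi> x\<bar> \<le> K3 * exp (- K4 * t))"
    if M: "markov_process M X P" and rates: "has_rates P ?q" and pos: "\<P>(\<omega> in M. X 0 \<omega> = 0) > 0"
  proof -
    have "transition_function P" using M by (simp add: markov_process_def)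
    then interpret finite_rate_chain P ?q neighbours
      using rates neighbours_basic by unfold_locales auto
    interpret lyapunov_chain P ?q neighbours "lyap_G lam \<delta>" \<gamma> b 0
    proof
      show "gen (lyap_G lam \<delta>) x \<le> b - \<gamma> * lyap_G lam \<delta> x" for x
        unfolding gen_def using gen[of x] by (subst sum_jump_rate_eq_generator) (auto simp: mPF_def)
      show "0 \<in> set_pmf (P t x)" if "t > 0" for t x
        using mPF_descent[OF lam] that by (rule reach_positive[where m="\<lambda>x. \<Sum>i\<in>UNIV. x $ i"])
    qed (use \<gamma> sum0 finite_sublevel_lyap_G[OF lam \<delta>] in \<open>auto simp: lyap_G_def b_def\<close>)
    show ?thesis
      using exponential_ergodicity markov_process_cond_prob[OF M pos] by simp
  qed
  with part1 show ?thesis by blast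
qed

end
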